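(* Let $({}_{f_2}M_1\times_{f_1}M_2,F)$ be a doubly warped product Finsler manifold. Suppose that $F$ is a relatively isotropic Landsberg metric, i.e. ${\bf L}=cF\,{\bf C}$ for some scalar function $c$ on $M_1\times M_2$. Then $F$ is a Landsberg metric, i.e. ${\bf L}=0$.
   Context: A Finsler metric on a smooth manifold $N$ is a function $F:TN\to[0,\infty)$ that is $C^\infty$ off the zero section, positively 1-homogeneous on fibers, and whose fundamental tensor $g_{ij}=\frac12\frac{\partial^2F^2}{\partial y^i\partial y^j}$ is positive definite at every nonzero $y$, where $(x^i,y^i)$ are standard coordinates on $TN$. $(g^{ij})$ is the inverse matrix of $(g_{ij})$ and $y_l=g_{lk}y^k$. Doubly warped product (DWP): given Finsler manifolds $(M_1,F_1)$, $(M_2,F_2)$ and smooth functions $f_1:M_1\to\mathbb{R}^+$, $f_2:M_2\to\mathbb{R}^+$, the DWP-Finsler manifold $({}_{f_2}M_1\times_{f_1}M_2,F)$ is $M_1\times M_2$ with $F(v_1,v_2)=\sqrt{f_2^2(\pi_2(v_2))F_1^2(v_1)+f_1^2(\pi_1(v_1))F_2^2(v_2)}$, where $\pi_1,\pi_2$ denote the base points in $M_1,M_2$. $F$ is considered on $TM_1^\circ\times TM_2^\circ$, where $TM_i^\circ=TM_i\setminus\{0\}$, and all tensors of $F$ are taken there. Tensors of a Finsler metric: the Cartan torsion ${\bf C}$ has components $C_{ijk}=\frac12\frac{\partial g_{ij}}{\partial y^k}$; the spray coefficients are $G^i=\frac14g^{il}\{\frac{\partial^2F^2}{\partial x^k\partial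 y^l}y^k-\frac{\partial F^2}{\partial x^l}\}$; the Berwald curvature is $B^i_{\ jkl}=\frac{\partial^3G^i}{\partial y^j\partial y^k\partial y^l}$; the Landsberg curvature ${\bf L}$ has components $L_{ijk}=-\frac12y_lB^l_{\ ijk}$. *)

theory Defs
  imports "HOL-Analysis.Analysis"
begin

text \<open>\<open>Ck_on k S f\<close> says that \<open>f\<close> is \<open>k\<close> times continuously differentiable; it is meant for open \<open>S\<close>.\<close>

primrec Ck_on :: "nat \<Rightarrow> 'a::real_normed_vector set \<Rightarrow> ('a \<Rightarrow> 'b::real_normed_vector) \<Rightarrow> bool" where
  "Ck_on 0 S f \<longleftrightarrow> continuous_on S f"
| "Ck_on (Suc k) S f \<longleftrightarrow>
     (\<forall>x\<in>S. f differentiable (at x)) \<and> (\<forall>v. Ck_on k S (\<lambda>x. frechet_derivative f (at x) v))"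

definition smooth_on :: "'a::real_normed_vector set \<Rightarrow> ('a \<Rightarrow> 'b::real_normed_vector) \<Rightarrow> bool" where
  "smooth_on S f \<longleftrightarrow> (\<forall>k. Ck_on k S f)"

text \<open>A chart is a pair \<open>(U, \<phi>)\<close> of an open set and a coordinate map; only the values of \<open>\<phi>\<close> on \<open>U\<close> matter.\<close>

type_synonym ('m, 'a) chart = "'m set \<times> ('m \<Rightarrow> 'a)"

abbreviation chart_dom :: "('m, 'a) chart \<Rightarrow> 'm set" where
  "chart_dom \<equiv> fst"

abbreviation coord :: "('m, 'a) chart \<Rightarrow> 'm \<Rightarrow> 'a" where
  "coord \<equiv> snd"

definition chart_range :: "('m, 'a) chart \<Rightarrow> 'a set" where
  "chart_range c = coord c ` chart_dom c"

definition inv_coord :: "('m, 'a) chart \<Rightarrow> 'a \<Rightarrow> 'm" where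
  "inv_coord c = inv_into (chart_dom c) (coord c)"

definition is_chart :: "('m::topological_space, 'a::euclidean_space) chart \<Rightarrow> bool" where
  "is_chart c \<longleftrightarrow> open (chart_dom c) \<and> open (chart_range c) \<and>
     homeomorphism (chart_dom c) (chart_range c) (coord c) (inv_coord c)"

text \<open>
  The manifold is the whole type \<open>'m\<close>. Its dimension is \<open>DIM('a)\<close>. The atlas need not be maximal.
\<close>

definition smooth_manifold ::
  "('m::{t2_space, second_countable_topology}, 'a::euclidean_space) chart set \<Rightarrow> bool" where
  "smooth_manifold A \<longleftrightarrow>
     (\<forall>c\<in>A. is_chart c) \<and>
     (\<Union>c\<in>A. chart_dom c) = UNIV \<and>
     (\<forall>c\<in>A. \<forall>d\<in>A. smooth_on (coord c ` (chart_dom c \<inter> chart_dom d)) (coord d \<circ> inv_coord c))"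

definition smooth_fun :: "('m, 'a::euclidean_space) chart set \<Rightarrow> ('m \<Rightarrow> real) \<Rightarrow> bool" where
  "smooth_fun A f \<longleftrightarrow> (\<forall>c\<in>A. smooth_on (chart_range c) (f \<circ> inv_coord c))"

text \<open>
  A tangent vector at \<open>p\<close> is given by its components in all charts around \<open>p\<close>, which have to
  transform by the derivatives of the transition maps. The value at all other arguments is
  fixed to be \<open>0\<close>, so that equality of tangent vectors is equality of functions.
\<close>

type_synonym ('m, 'a) tangent = "'m \<times> (('m, 'a) chart \<Rightarrow> 'a)"

definition tangent_bundle :: "('m, 'a::euclidean_space) chart set \<Rightarrow> ('m, 'a) tangent set" where
  "tangent_bundle A = {(p, v).
     (\<forall>c. \<not> (c \<in> A \<and> p \<in> chart_dom c) \<longrightarrow> v c = 0) \<and>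
     (\<forall>c\<in>A. \<forall>d\<in>A. p \<in> chart_dom c \<longrightarrow> p \<in> chart_dom d \<longrightarrow>
        v d = frechet_derivative (coord d \<circ> inv_coord c) (at (coord c p)) (v c))}"

definition zero_vector :: "('m, 'a::euclidean_space) tangent \<Rightarrow> bool" where
  "zero_vector w \<longleftrightarrow> snd w = (\<lambda>_. 0)"

definition scale_tangent :: "real \<Rightarrow> ('m, 'a::euclidean_space) tangent \<Rightarrow> ('m, 'a) tangent" where
  "scale_tangent r w = (fst w, \<lambda>c. r *\<^sub>R snd w c)"

text \<open>The tangent vector with standard coordinates \<open>(x, y)\<close> in the chart \<open>c\<close>.\<close>

definition tangent_of ::
  "('m, 'a::euclidean_space) chart set \<Rightarrow> ('m, 'a) chart \<Rightarrow> 'a \<Rightarrow> 'a \<Rightarrow> ('m, 'a) tangent" where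
  "tangent_of A c x y =
     (inv_coord c x,
      \<lambda>d. if d \<in> A \<and> inv_coord c x \<in> chart_dom d
          then frechet_derivative (coord d \<circ> inv_coord c) (at x) y else 0)"

definition local_rep ::
  "('m, 'a::euclidean_space) chart set \<Rightarrow> (('m, 'a) tangent \<Rightarrow> real) \<Rightarrow> ('m, 'a) chart \<Rightarrow> 'a \<Rightarrow> 'a \<Rightarrow> real" where
  "local_rep A F c x y = F (tangent_of A c x y)"

text \<open>The differential of a map \<open>h\<close> between manifolds; it does not depend on the chart chosen at the source.\<close>

definition differential ::
  "('m, 'a::euclidean_space) chart set \<Rightarrow> ('n, 'b::euclidean_space) chart set \<Rightarrow> ('m \<Rightarrow> 'n) \<Rightarrow>
    ('m, 'a) tangent \<Rightarrow> ('n, 'b) tangent" where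
  "differential A B h w =
     (let p = fst w; c = (SOME c. c \<in> A \<and> p \<in> chart_dom c)
      in (h p, \<lambda>d. if d \<in> B \<and> h p \<in> chart_dom d
                   then frechet_derivative (coord d \<circ> h \<circ> inv_coord c) (at (coord c p)) (snd w c)
                   else 0))"

text \<open>
  Here \<open>H x y\<close> is a Finsler function in standard coordinates. Indices range over the
  standard basis, so that \<open>y \<bullet> k\<close> is the component of \<open>y\<close> with index \<open>k\<close>.
\<close>

definition dx :: "'a::euclidean_space \<Rightarrow> ('a \<Rightarrow> 'a \<Rightarrow> real) \<Rightarrow> 'a \<Rightarrow> 'a \<Rightarrow> real" where
  "dx i H x y = deriv (\<lambda>t. H (x + t *\<^sub>R i) y) 0"

definition dy :: "'a::euclidean_space \<Rightarrow> ('a \<Rightarrow> 'a \<Rightarrow> real) \<Rightarrow> 'a \<Rightarrow> 'a \<Rightarrow> real" where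
  "dy i H x y = deriv (\<lambda>t. H x (y + t *\<^sub>R i)) 0"

definition sq :: "('a \<Rightarrow> 'a \<Rightarrow> real) \<Rightarrow> 'a \<Rightarrow> 'a \<Rightarrow> real" where
  "sq H x y = (H x y)\<^sup>2"

definition fund :: "('a::euclidean_space \<Rightarrow> 'a \<Rightarrow> real) \<Rightarrow> 'a \<Rightarrow> 'a \<Rightarrow> 'a \<Rightarrow> 'a \<Rightarrow> real" where
  "fund H i j x y = 1/2 * dy i (dy j (sq H)) x y"

definition inverse_on_Basis :: "('a::euclidean_space \<Rightarrow> 'a \<Rightarrow> real) \<Rightarrow> 'a \<Rightarrow> 'a \<Rightarrow> real" where
  "inverse_on_Basis g = (SOME h. \<forall>i\<in>Basis. \<forall>j\<in>Basis.
     (\<Sum>k\<in>Basis. g i k * h k j) = (if i = j then 1 else 0) \<and>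
     (\<Sum>k\<in>Basis. h i k * g k j) = (if i = j then 1 else 0))"

definition fund_inv :: "('a::euclidean_space \<Rightarrow> 'a \<Rightarrow> real) \<Rightarrow> 'a \<Rightarrow> 'a \<Rightarrow> 'a \<Rightarrow> 'a \<Rightarrow> real" where
  "fund_inv H i j x y = inverse_on_Basis (\<lambda>k l. fund H k l x y) i j"

definition cartan :: "('a::euclidean_space \<Rightarrow> 'a \<Rightarrow> real) \<Rightarrow> 'a \<Rightarrow> 'a \<Rightarrow> 'a \<Rightarrow> 'a \<Rightarrow> 'a \<Rightarrow> real" where
  "cartan H i j k x y = 1/2 * dy k (fund H i j) x y"

definition spray :: "('a::euclidean_space \<Rightarrow> 'a \<Rightarrow> real) \<Rightarrow> 'a \<Rightarrow> 'a \<Rightarrow> 'a \<Rightarrow> real" where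
  "spray H i x y = 1/4 * (\<Sum>l\<in>Basis. fund_inv H i l x y *
     ((\<Sum>k\<in>Basis. dx k (dy l (sq H)) x y * (y \<bullet> k)) - dx l (sq H) x y))"

definition berwald :: "('a::euclidean_space \<Rightarrow> 'a \<Rightarrow> real) \<Rightarrow> 'a \<Rightarrow> 'a \<Rightarrow> 'a \<Rightarrow> 'a \<Rightarrow> 'a \<Rightarrow> 'a \<Rightarrow> real" where
  "berwald H i j k l = dy j (dy k (dy l (spray H i)))"

definition y_lower :: "('a::euclidean_space \<Rightarrow> 'a \<Rightarrow> real) \<Rightarrow> 'a \<Rightarrow> 'a \<Rightarrow> 'a \<Rightarrow> real" where
  "y_lower H l x y = (\<Sum>k\<in>Basis. fund H l k x y * (y \<bullet> k))"

definition landsberg :: "('a::euclidean_space \<Rightarrow> 'a \<Rightarrow> real) \<Rightarrow> 'a \<Rightarrow> 'a \<Rightarrow> 'a \<Rightarrow> 'a \<Rightarrow> 'a \<Rightarrow> real" where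
  "landsberg H i j k x y = - 1/2 * (\<Sum>l\<in>Basis. y_lower H l x y * berwald H l i j k x y)"

definition finsler_metric ::
  "('m, 'a::euclidean_space) chart set \<Rightarrow> (('m, 'a) tangent \<Rightarrow> real) \<Rightarrow> bool" where
  "finsler_metric A F \<longleftrightarrow>
     (\<forall>w\<in>tangent_bundle A. 0 \<le> F w) \<and>
     (\<forall>c\<in>A. smooth_on (chart_range c \<times> (UNIV - {0})) (\<lambda>(x, y). local_rep A F c x y)) \<and>
     (\<forall>w\<in>tangent_bundle A. \<forall>r>0. F (scale_tangent r w) = r * F w) \<and>
     (\<forall>c\<in>A. \<forall>x\<in>chart_range c. \<forall>y. y \<noteq> 0 \<longrightarrow>
        (\<forall>v. v \<noteq> 0 \<longrightarrow>
          0 < (\<Sum>i\<in>Basis. \<Sum>j\<in>Basis. fund (local_rep A F c) i j x y * (v \<bullet> i) * (v \<bullet> j))))"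

definition finsler_manifold ::
  "('m::{t2_space, second_countable_topology}, 'a::euclidean_space) chart set \<Rightarrow>
    (('m, 'a) tangent \<Rightarrow> real) \<Rightarrow> bool" where
  "finsler_manifold A F \<longleftrightarrow> smooth_manifold A \<and> finsler_metric A F"

text \<open>
  The following two notions are relative to a domain \<open>D\<close> in the tangent bundle. Equality of
  tensors is equality of components in every chart of the atlas.
\<close>

definition relatively_isotropic_landsberg_on ::
  "('m, 'a::euclidean_space) chart set \<Rightarrow> ('m, 'a) tangent set \<Rightarrow> (('m, 'a) tangent \<Rightarrow> real) \<Rightarrow> ('m \<Rightarrow> real) \<Rightarrow> bool" where
  "relatively_isotropic_landsberg_on A D F c \<longleftrightarrow>
     (\<forall>w\<in>D. \<forall>\<kappa>\<in>A. fst w \<in> chart_dom \<kappa> \<longrightarrow> (\<forall>i\<in>Basis. \<forall>j\<in>Basis. \<forall>k\<in>Basis.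
        landsberg (local_rep A F \<kappa>) i j k (coord \<kappa> (fst w)) (snd w \<kappa>) =
        c (fst w) * F w * cartan (local_rep A F \<kappa>) i j k (coord \<kappa> (fst w)) (snd w \<kappa>)))"

definition landsberg_metric_on ::
  "('m, 'a::euclidean_space) chart set \<Rightarrow> ('m, 'a) tangent set \<Rightarrow> (('m, 'a) tangent \<Rightarrow> real) \<Rightarrow> bool" where
  "landsberg_metric_on A D F \<longleftrightarrow>
     (\<forall>w\<in>D. \<forall>\<kappa>\<in>A. fst w \<in> chart_dom \<kappa> \<longrightarrow> (\<forall>i\<in>Basis. \<forall>j\<in>Basis. \<forall>k\<in>Basis.
        landsberg (local_rep A F \<kappa>) i j k (coord \<kappa> (fst w)) (snd w \<kappa>) = 0))"

definition product_chart :: "('m, 'a) chart \<Rightarrow> ('n, 'b) chart \<Rightarrow> ('m \<times> 'n, 'a \<times> 'b) chart" where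
  "product_chart c d = (chart_dom c \<times> chart_dom d, map_prod (coord c) (coord d))"

definition product_atlas ::
  "('m, 'a) chart set \<Rightarrow> ('n, 'b) chart set \<Rightarrow> ('m \<times> 'n, 'a \<times> 'b) chart set" where
  "product_atlas A B = {product_chart c d | c d. c \<in> A \<and> d \<in> B}"

text \<open>
  A tangent vector \<open>w\<close> of the product is the pair \<open>(v\<^sub>1, v\<^sub>2)\<close> of its images under the
  differentials of the two projections.
\<close>

definition tangent_fst ::
  "('m, 'a::euclidean_space) chart set \<Rightarrow> ('n, 'b::euclidean_space) chart set \<Rightarrow>
    ('m \<times> 'n, 'a \<times> 'b) tangent \<Rightarrow> ('m, 'a) tangent" where
  "tangent_fst A B = differential (product_atlas A B) A fst"

definition tangent_snd ::
  "('m, 'a::euclidean_space) chart set \<Rightarrow> ('n, 'b::euclidean_space) chart set \<Rightarrow>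
    ('m \<times> 'n, 'a \<times> 'b) tangent \<Rightarrow> ('n, 'b) tangent" where
  "tangent_snd A B = differential (product_atlas A B) B snd"

definition doubly_warped ::
  "('m, 'a::euclidean_space) chart set \<Rightarrow> ('n, 'b::euclidean_space) chart set \<Rightarrow>
    (('m, 'a) tangent \<Rightarrow> real) \<Rightarrow> (('n, 'b) tangent \<Rightarrow> real) \<Rightarrow> ('m \<Rightarrow> real) \<Rightarrow> ('n \<Rightarrow> real) \<Rightarrow>
    ('m \<times> 'n, 'a \<times> 'b) tangent \<Rightarrow> real" where
  "doubly_warped A B F\<^sub>1 F\<^sub>2 f\<^sub>1 f\<^sub>2 w =
     (let v\<^sub>1 = tangent_fst A B w; v\<^sub>2 = tangent_snd A B w
      in sqrt ((f\<^sub>2 (fst v\<^sub>2))\<^sup>2 * (F\<^sub>1 v\<^sub>1)\<^sup>2 + (f\<^sub>1 (fst v\<^sub>1))\<^sup>2 * (F\<^sub>2 v\<^sub>2)\<^sup>2))"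

text \<open>
  The set of pairs of nonzero vectors. The doubly warped metric need not be smooth
  at the other nonzero vectors of the product.
\<close>

definition doubly_slit_bundle ::
  "('m, 'a::euclidean_space) chart set \<Rightarrow> ('n, 'b::euclidean_space) chart set \<Rightarrow>
    ('m \<times> 'n, 'a \<times> 'b) tangent set" where
  "doubly_slit_bundle A B = {w \<in> tangent_bundle (product_atlas A B).
     \<not> zero_vector (tangent_fst A B w) \<and> \<not> zero_vector (tangent_snd A B w)}"

end

theory Submission
  imports Defs
begin

text \<open>
  In product coordinates \<open>F\<^sup>2 = u\<^sub>2 F\<^sub>1\<^sup>2 + u\<^sub>1 F\<^sub>2\<^sup>2\<close> with \<open>u\<^sub>i = f\<^sub>i\<^sup>2\<close>, so \<open>g\<^sub>i\<^sub>j\<close> is block diagonal and the mixed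
  components of the Cartan torsion vanish. Take \<open>i, j, k\<close> in the first block and replace \<open>y\<^sub>2\<close> by \<open>t y\<^sub>2\<close>
  with \<open>t > 0\<close>. By homogeneity \<open>L\<^sub>i\<^sub>j\<^sub>k\<close> is a quadratic polynomial in \<open>t\<close>, while \<open>C\<^sub>i\<^sub>j\<^sub>k\<close> does not depend
  on \<open>t\<close> and \<open>F = sqrt (p + q t\<^sup>2)\<close> with \<open>p, q > 0\<close>. Such a square root is not a polynomial, so
  \<open>L = c F C\<close> forces \<open>c C\<^sub>i\<^sub>j\<^sub>k = 0\<close> and hence \<open>L\<^sub>i\<^sub>j\<^sub>k = 0\<close>. The second block is symmetric.
\<close>

section \<open>Smooth functions\<close>

text \<open>Why \<open>L\<close> is quadratic in \<open>t\<close>: for \<open>l\<close> in the first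
  block, the spray of \<open>F\<close> is the spray of \<open>F_1\<close>, plus a term linear in
  \<open>y_2\<close> coming from the derivative of \<open>u_2\<close>, plus a multiple of
  \<open>F_2^2\<close> coming from the gradient of \<open>u_1\<close>. Every term is a function of
  \<open>y_2\<close> times a function of \<open>y_1\<close>, and three
  \<open>y_1\<close>-derivatives act on the latter only. The contraction in \<open>L\<close> also
  runs over the second block. There the spray of \<open>F_2\<close> is constant in
  \<open>y_1\<close> and is killed; what remains has degree 0 or 1 in \<open>y_2\<close>, and the
  lowered \<open>y_l\<close> adds one more. So only degrees are counted and \<open>L\<close> is
  never computed. The scalar \<open>c\<close> depends on the base point alone and is untouched by
  the rescaling. For mixed indices \<open>C = 0\<close>, so the hypothesis gives
  \<open>L = 0\<close> at once. The obstacle is regularity. Splitting a \<open>deriv\<close> over a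
  sum needs every summand differentiable, three times in a row, and the inverse matrix in the spray
  is given only by \<open>SOME\<close>. Its smoothness is derived from the identity
  \<open>h - h' = - h (g - g') h'\<close> for inverses \<open>h\<close>, \<open>h'\<close> of
  \<open>g\<close>, \<open>g'\<close>.\<close>

lemma Ck_on_cong:
  assumes "open S"
  shows "Ck_on k S f \<Longrightarrow> (\<And>x. x \<in> S \<Longrightarrow> f x = g x) \<Longrightarrow> Ck_on k S g"
proof (induction k arbitrary: f g)
  case 0
  then show ?case by (auto cong: continuous_on_cong)
next
  case (Suc k)
  have d: "(f has_derivative frechet_derivative f (at x)) (at x)" if "x \<in> S" for x
    using Suc.prems that by (simp add: frechet_derivative_works)
  have d': "(g has_derivative frechet_derivative f (at x)) (at x)" if "x \<in> S" for x
    using has_derivative_transform_within_open[OF d[OF that] assms that] Suc.prems(2) by blast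
  have "Ck_on k S (\<lambda>x. frechet_derivative g (at x) v)" for v
    by (rule Suc.IH[of "\<lambda>x. frechet_derivative f (at x) v"])
      (use Suc.prems(1) frechet_derivative_at[OF d'] in auto)
  then show ?case using d' by (auto simp: differentiable_def)
qed

text \<open>\<open>Ck_on\<close> speaks of \<open>frechet_derivative\<close>, a chosen object. By
  uniqueness of derivatives on an open set, any explicit formula \<open>f'\<close> may replace
  it.\<close>

lemma Ck_on_SucI:
  assumes S: "open S" and d: "\<And>x. x \<in> S \<Longrightarrow> (f has_derivative f' x) (at x)"
    and C: "\<And>v. Ck_on k S (\<lambda>x. f' x v)"
  shows "Ck_on (Suc k) S f"
proof -
  have "frechet_derivative f (at x) = f' x" if "x \<in> S" for x
    using frechet_derivative_at[OF d[OF that]] by simp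
  then have "Ck_on k S (\<lambda>x. frechet_derivative f (at x) v)" for v
    using Ck_on_cong[OF S C[of v]] by simp
  then show ?thesis using d by (auto simp: differentiable_def)
qed

lemma Ck_on_Suc_deriv:
  "Ck_on (Suc k) S f \<Longrightarrow> x \<in> S \<Longrightarrow> (f has_derivative frechet_derivative f (at x)) (at x)"
  by (simp add: frechet_derivative_works)

lemma Ck_on_lower: "Ck_on (Suc k) S f \<Longrightarrow> Ck_on k S f"
  by (induction k arbitrary: f)
    (auto intro!: continuous_at_imp_continuous_on differentiable_imp_continuous_within)

lemma Ck_on_const: "Ck_on k S (\<lambda>x. c)"
proof (induction k arbitrary: c)
  case (Suc k)
  have "frechet_derivative (\<lambda>x::'a. c) (at x) = (\<lambda>_. 0)" for x
    using frechet_derivative_at[OF has_derivative_const] by metis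
  then show ?case using Suc by simp
qed simp

lemma Ck_on_add:
  assumes S: "open S"
  shows "Ck_on k S f \<Longrightarrow> Ck_on k S g \<Longrightarrow> Ck_on k S (\<lambda>x. f x + g x)"
proof (induction k arbitrary: f g)
  case 0
  then show ?case by (simp add: continuous_on_add)
next
  case (Suc k)
  show ?case
    by (rule Ck_on_SucI[OF S has_derivative_add[OF Suc.prems[THEN Ck_on_Suc_deriv]]])
      (use Suc in auto)
qed

lemma Ck_on_mult:
  fixes f g :: "_ \<Rightarrow> real"
  assumes S: "open S"
  shows "Ck_on k S f \<Longrightarrow> Ck_on k S g \<Longrightarrow> Ck_on k S (\<lambda>x. f x * g x)"
proof (induction k arbitrary: f g)
  case 0
  then show ?case by (simp add: continuous_on_mult)
next
  case (Suc k)
  show ?case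
    by (rule Ck_on_SucI[OF S has_derivative_mult[OF Suc.prems[THEN Ck_on_Suc_deriv]]])
      (use Suc Suc.prems[THEN Ck_on_lower] in \<open>auto intro!: Ck_on_add[OF S]\<close>)
qed

text \<open>The linear part \<open>L\<close> is constant, so the derivative of the composite is
  again a derivative of \<open>f\<close> composed with the same affine map. The induction therefore
  closes without a chain rule for general inner functions. Slices of functions of two variables are
  the use.\<close>

lemma Ck_on_affine:
  assumes T: "open T" and L: "bounded_linear L" and sub: "\<And>y. y \<in> T \<Longrightarrow> a + L y \<in> S"
  shows "Ck_on k S f \<Longrightarrow> Ck_on k T (\<lambda>y. f (a + L y))"
proof (induction k arbitrary: f)
  case 0
  then have "continuous_on S f" by simp
  moreover have "continuous_on T (\<lambda>y. a + L y)"
    by (intro continuous_intros linear_continuous_on L)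
  ultimately show ?case using sub by (auto intro: continuous_on_compose2)
next
  case (Suc k)
  have "((\<lambda>y. f (a + L y)) has_derivative (\<lambda>v. frechet_derivative f (at (a + L y)) (L v))) (at y)"
    if "y \<in> T" for y
  proof -
    have "((\<lambda>y. a + L y) has_derivative L) (at y)"
      using L by (auto intro!: derivative_eq_intros bounded_linear_imp_has_derivative)
    from diff_chain_at[OF this Ck_on_Suc_deriv[OF Suc.prems sub[OF that]]]
    show ?thesis by (simp add: o_def)
  qed
  then show ?case by (rule Ck_on_SucI[OF T]) (use Suc in auto)
qed

lemma smooth_on_cong:
  "open S \<Longrightarrow> smooth_on S f \<Longrightarrow> (\<And>x. x \<in> S \<Longrightarrow> f x = g x) \<Longrightarrow> smooth_on S g"
  unfolding smooth_on_def by (metis Ck_on_cong)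

lemma smooth_on_const: "smooth_on S (\<lambda>x. c)"
  by (simp add: smooth_on_def Ck_on_const)

lemma smooth_on_add: "open S \<Longrightarrow> smooth_on S f \<Longrightarrow> smooth_on S g \<Longrightarrow> smooth_on S (\<lambda>x. f x + g x)"
  by (simp add: smooth_on_def Ck_on_add)

lemma smooth_on_mult:
  fixes f g :: "_ \<Rightarrow> real"
  shows "open S \<Longrightarrow> smooth_on S f \<Longrightarrow> smooth_on S g \<Longrightarrow> smooth_on S (\<lambda>x. f x * g x)"
  by (simp add: smooth_on_def Ck_on_mult)

lemma smooth_on_diff:
  fixes f g :: "_ \<Rightarrow> real"
  assumes "open S" "smooth_on S f" "smooth_on S g"
  shows "smooth_on S (\<lambda>x. f x - g x)"
  using smooth_on_add[OF assms(1,2) smooth_on_mult[OF assms(1) smooth_on_const[of S "-1"] assms(3)]]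
  by simp

lemma smooth_on_sum:
  assumes "open S" "\<And>i. i \<in> I \<Longrightarrow> smooth_on S (f i)"
  shows "smooth_on S (\<lambda>x. \<Sum>i\<in>I. f i x)"
proof (cases "finite I")
  case True
  then show ?thesis using assms(2)
    by (induction I) (auto simp: smooth_on_const intro!: smooth_on_add[OF assms(1)])
qed (simp add: smooth_on_const)

lemma smooth_on_affine:
  assumes "smooth_on S f" "open T" "bounded_linear L" "\<And>y. y \<in> T \<Longrightarrow> a + L y \<in> S"
  shows "smooth_on T (\<lambda>y. f (a + L y))"
  unfolding smooth_on_def
proof
  show "Ck_on k T (\<lambda>y. f (a + L y))" for k
    by (rule Ck_on_affine[OF assms(2-)]) (use assms(1) in \<open>simp_all add: smooth_on_def\<close>)
qed

lemma smooth_on_has_derivative: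
  "smooth_on S f \<Longrightarrow> x \<in> S \<Longrightarrow> (f has_derivative frechet_derivative f (at x)) (at x)"
  by (metis smooth_on_def Ck_on_Suc_deriv)

lemma smooth_on_frechet: "smooth_on S f \<Longrightarrow> smooth_on S (\<lambda>x. frechet_derivative f (at x) v)"
  by (metis smooth_on_def Ck_on.simps(2))

lemma smooth_on_linear:
  fixes L :: "'a::real_normed_vector \<Rightarrow> 'b::real_normed_vector"
  assumes "bounded_linear L" "open S"
  shows "smooth_on S L"
proof -
  have "Ck_on k S L" for k
  proof (cases k)
    case (Suc k)
    show ?thesis unfolding Suc
      by (rule Ck_on_SucI[OF assms(2) bounded_linear_imp_has_derivative[OF assms(1)] Ck_on_const])
  qed (simp add: linear_continuous_on assms)
  then show ?thesis by (simp add: smooth_on_def)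
qed

section \<open>Directional derivatives\<close>

text \<open>Common form of \<open>dx\<close> and \<open>dy\<close> as an operator on functions of
  one vector, so that it can be iterated and the calculus is done once for both.\<close>

definition dirderiv :: "'a::real_normed_vector \<Rightarrow> ('a \<Rightarrow> real) \<Rightarrow> 'a \<Rightarrow> real" where
  "dirderiv v f y = deriv (\<lambda>t. f (y + t *\<^sub>R v)) 0"

lemma dy_eq: "dy i H x = dirderiv i (H x)"
  by (simp add: dy_def dirderiv_def fun_eq_iff)

lemma dx_eq: "dx i H x y = dirderiv i (\<lambda>x. H x y) x"
  by (simp add: dx_def dirderiv_def)

lemma has_derivative_line:
  assumes "(f has_derivative f') (at (y + s *\<^sub>R v))"
  shows "((\<lambda>t. f (y + t *\<^sub>R v)) has_real_derivative f' v) (at s)"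
proof -
  have "((\<lambda>t. y + t *\<^sub>R v) has_derivative (\<lambda>t. t *\<^sub>R v)) (at s)"
    by (auto intro!: derivative_eq_intros)
  from diff_chain_at[OF this assms]
  have "((\<lambda>t. f (y + t *\<^sub>R v)) has_derivative (\<lambda>t. f' (t *\<^sub>R v))) (at s)"
    by (simp add: o_def)
  moreover have "f' (t *\<^sub>R v) = f' v * t" for t
    using has_derivative_bounded_linear[OF assms]
    by (simp add: bounded_linear.linear linear_cmul)
  ultimately show ?thesis by (simp add: has_field_derivative_def)
qed

lemma has_derivative_imp_dirderiv:
  assumes "(f has_derivative f') (at y)"
  shows "dirderiv v f y = f' v"
  using has_derivative_line[of f f' y 0 v] assms by (simp add: dirderiv_def DERIV_imp_deriv)

lemma smooth_on_dirderiv_eq: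
  "smooth_on S f \<Longrightarrow> y \<in> S \<Longrightarrow> dirderiv v f y = frechet_derivative f (at y) v"
  by (rule has_derivative_imp_dirderiv[OF smooth_on_has_derivative])

lemma smooth_on_dirderiv: "open S \<Longrightarrow> smooth_on S f \<Longrightarrow> smooth_on S (dirderiv v f)"
  by (rule smooth_on_cong[OF _ smooth_on_frechet[of S f v]]) (auto simp: smooth_on_dirderiv_eq)

lemma dirderiv_cong:
  assumes "open S" "y \<in> S" "\<And>z. z \<in> S \<Longrightarrow> f z = g z"
  shows "dirderiv v f y = dirderiv v g y"
proof -
  have "open ((\<lambda>t. y + t *\<^sub>R v) -` S)"
    by (intro open_vimage assms(1) continuous_intros)
  then have "\<forall>\<^sub>F t in nhds 0. y + t *\<^sub>R v \<in> S"
    using assms(2) by (auto simp: eventually_nhds intro!: exI[of _ "(\<lambda>t. y + t *\<^sub>R v) -` S"])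
  then have "\<forall>\<^sub>F t in nhds 0. f (y + t *\<^sub>R v) = g (y + t *\<^sub>R v)"
    by (rule eventually_mono) (rule assms(3))
  then show ?thesis by (auto simp: dirderiv_def intro: deriv_cong_ev)
qed

lemma dirderiv_const: "dirderiv v (\<lambda>y. c) = (\<lambda>y. 0)"
  by (simp add: dirderiv_def fun_eq_iff)

lemma dirderiv_cmult_add:
  assumes "smooth_on S f" "smooth_on S g" "y \<in> S"
  shows "dirderiv v (\<lambda>z. a * f z + b * g z) y = a * dirderiv v f y + b * dirderiv v g y"
proof -
  have "((\<lambda>z. a * f z + b * g z) has_derivative
      (\<lambda>v. a * frechet_derivative f (at y) v + b * frechet_derivative g (at y) v)) (at y)"
    by (intro has_derivative_add has_derivative_mult_right smooth_on_has_derivative assms)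
      (use assms in auto)
  then show ?thesis
    using assms by (simp add: has_derivative_imp_dirderiv smooth_on_dirderiv_eq)
qed

lemma dirderiv_cmult:
  assumes "smooth_on S f" "y \<in> S"
  shows "dirderiv v (\<lambda>z. a * f z) y = a * dirderiv v f y"
  using dirderiv_cmult_add[OF assms(1) assms(1,2), of v a 0] by simp

lemma dirderiv_cmult_add3:
  assumes S: "open S" and s: "smooth_on S f" "smooth_on S g" "smooth_on S h" and y: "y \<in> S"
    and eq: "\<And>z. z \<in> S \<Longrightarrow> F z = a * f z + b * g z + c * h z"
  shows "dirderiv v F y = a * dirderiv v f y + b * dirderiv v g y + c * dirderiv v h y"
proof -
  have fg: "smooth_on S (\<lambda>z. a * f z + b * g z)"
    by (intro smooth_on_add smooth_on_mult smooth_on_const S s)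
  have "dirderiv v F y = dirderiv v (\<lambda>z. 1 * (a * f z + b * g z) + c * h z) y"
    by (rule dirderiv_cong[OF S y]) (simp add: eq)
  also have "\<dots> = 1 * dirderiv v (\<lambda>z. a * f z + b * g z) y + c * dirderiv v h y"
    by (rule dirderiv_cmult_add[OF fg s(3) y])
  finally show ?thesis by (simp add: dirderiv_cmult_add[OF s(1,2) y])
qed

text \<open>Three summands because the spray of the warped product has three. The coefficients are
  the factors that stay fixed under differentiation within one block.\<close>

lemma dirderiv3_cmult_add3:
  assumes S: "open S" and s: "smooth_on S f" "smooth_on S g" "smooth_on S h" and y: "y \<in> S"
    and eq: "\<And>z. z \<in> S \<Longrightarrow> F z = a * f z + b * g z + c * h z"
  shows "dirderiv i (dirderiv j (dirderiv k F)) y =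
    a * dirderiv i (dirderiv j (dirderiv k f)) y + b * dirderiv i (dirderiv j (dirderiv k g)) y
    + c * dirderiv i (dirderiv j (dirderiv k h)) y"
  by (intro dirderiv_cmult_add3[OF S] smooth_on_dirderiv S s y eq)

text \<open>Differentiate \<open>f (t y + s v) = t ^ Suc n * f (y + (s/t) v)\<close> at
  \<open>s = 0\<close>: the inner factor \<open>1/t\<close> lowers the degree by one.\<close>

lemma dirderiv_homogeneous:
  assumes hom: "\<And>z t. z \<in> S \<Longrightarrow> t > 0 \<Longrightarrow> f (t *\<^sub>R z) = t ^ Suc n * f z"
    and S: "open S" "smooth_on S f" "y \<in> S" and t: "t > 0"
  shows "dirderiv v f (t *\<^sub>R y) = t ^ n * dirderiv v f y"
proof -
  define c where "c s = t ^ Suc n * f (y + (s / t) *\<^sub>R v)" for s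
  have "((\<lambda>s. f (y + s *\<^sub>R v)) has_real_derivative dirderiv v f y) (at 0)"
    using has_derivative_line[of f _ y 0 v] smooth_on_has_derivative[OF S(2,3)]
      smooth_on_dirderiv_eq[OF S(2,3)] by auto
  then have "((\<lambda>s. f (y + s *\<^sub>R v)) has_real_derivative dirderiv v f y) (at (0 / t))" by simp
  from DERIV_chain'[OF DERIV_cdivide[OF DERIV_ident] this]
  have "(c has_real_derivative t ^ Suc n * (1 / t * dirderiv v f y)) (at 0)"
    unfolding c_def by (auto intro!: derivative_eq_intros simp: mult.commute)
  then have c': "deriv c 0 = t ^ n * dirderiv v f y" using t by (simp add: DERIV_imp_deriv)
  have "open ((\<lambda>s. y + (s / t) *\<^sub>R v) -` S)"
    by (intro open_vimage S(1) continuous_intros) (use t in auto)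
  then have "\<forall>\<^sub>F s in nhds 0. y + (s / t) *\<^sub>R v \<in> S"
    using S(3) by (auto simp: eventually_nhds intro!: exI[of _ "(\<lambda>s. y + (s / t) *\<^sub>R v) -` S"])
  then have "\<forall>\<^sub>F s in nhds 0. f (t *\<^sub>R y + s *\<^sub>R v) = c s"
  proof (rule eventually_mono)
    fix s assume "y + (s / t) *\<^sub>R v \<in> S"
    from hom[OF this t] show "f (t *\<^sub>R y + s *\<^sub>R v) = c s"
      using t by (simp add: c_def scaleR_right_distrib)
  qed
  then have "deriv (\<lambda>s. f (t *\<^sub>R y + s *\<^sub>R v)) 0 = deriv c 0" by (rule deriv_cong_ev) simp
  then show ?thesis by (simp add: c' dirderiv_def)
qed

lemma frechet_derivative_Basis_sum:
  fixes f :: "'a::euclidean_space \<Rightarrow> real"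
  assumes "smooth_on S f" "y \<in> S"
  shows "frechet_derivative f (at y) v = (\<Sum>i\<in>Basis. (v \<bullet> i) * dirderiv i f y)"
proof -
  have "linear (frechet_derivative f (at y))"
    using smooth_on_has_derivative[OF assms] has_derivative_linear by blast
  then have "frechet_derivative f (at y) (\<Sum>i\<in>Basis. (v \<bullet> i) *\<^sub>R i) =
      (\<Sum>i\<in>Basis. (v \<bullet> i) * frechet_derivative f (at y) i)"
    by (simp add: linear_sum linear_cmul)
  then show ?thesis using assms by (simp add: euclidean_representation smooth_on_dirderiv_eq)
qed

text \<open>A partial derivative is the directional derivative of the joint function along
  \<open>(v, 0)\<close> or \<open>(0, w)\<close>, and a slice is its composition with an affine
  embedding.\<close>

lemma smooth_on_partial:
  assumes f: "smooth_on (X \<times> Y) (\<lambda>(x, y). f x y)" and o: "open X" "open Y"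
  shows smooth_on_slice: "x \<in> X \<Longrightarrow> smooth_on Y (f x)"
    and smooth_on_slice_fst: "y \<in> Y \<Longrightarrow> smooth_on X (\<lambda>x. f x y)"
    and smooth_on_partial_fst: "smooth_on (X \<times> Y) (\<lambda>(x, y). dirderiv v (\<lambda>x. f x y) x)"
    and smooth_on_partial_snd: "smooth_on (X \<times> Y) (\<lambda>(x, y). dirderiv w (f x) y)"
proof -
  have bl: "bounded_linear (\<lambda>y. (0, y))" "bounded_linear (\<lambda>x. (x, 0))"
    by (auto intro!: bounded_linear_Pair bounded_linear_zero bounded_linear_ident)
  show "smooth_on Y (f x)" if "x \<in> X" for x
    using smooth_on_affine[OF f o(2) bl(1), of "(x, 0)"] that by simp
  show "smooth_on X (\<lambda>x. f x y)" if "y \<in> Y" for y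
    using smooth_on_affine[OF f o(1) bl(2), of "(0, y)"] that by simp
  have oXY: "open (X \<times> Y)" using o by (simp add: open_Times)
  have 1: "dirderiv (v, 0) (\<lambda>(x, y). f x y) z = (case z of (x, y) \<Rightarrow> dirderiv v (\<lambda>x. f x y) x)" for z
    by (cases z) (simp add: dirderiv_def)
  have 2: "dirderiv (0, w) (\<lambda>(x, y). f x y) z = (case z of (x, y) \<Rightarrow> dirderiv w (f x) y)" for z
    by (cases z) (simp add: dirderiv_def)
  show "smooth_on (X \<times> Y) (\<lambda>(x, y). dirderiv v (\<lambda>x. f x y) x)"
    by (rule smooth_on_cong[OF oXY smooth_on_dirderiv[OF oXY f, of "(v, 0)"]]) (simp add: 1)
  show "smooth_on (X \<times> Y) (\<lambda>(x, y). dirderiv w (f x) y)"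
    by (rule smooth_on_cong[OF oXY smooth_on_dirderiv[OF oXY f, of "(0, w)"]]) (simp add: 2)
qed

section \<open>Inverse matrices indexed by a basis\<close>

text \<open>The predicate under \<open>SOME\<close> in \<open>inverse_on_Basis\<close>. It
  constrains entries at basis vectors only, so inverses are unique only there.\<close>

definition inverse_pair :: "('a::euclidean_space \<Rightarrow> 'a \<Rightarrow> real) \<Rightarrow> ('a \<Rightarrow> 'a \<Rightarrow> real) \<Rightarrow> bool" where
  "inverse_pair g h \<longleftrightarrow> (\<forall>i\<in>Basis. \<forall>j\<in>Basis.
     (\<Sum>k\<in>Basis. g i k * h k j) = (if i = j then 1 else 0) \<and>
     (\<Sum>k\<in>Basis. h i k * g k j) = (if i = j then 1 else 0))"

lemma inverse_pairD:
  assumes "inverse_pair g h" "i \<in> Basis" "j \<in> Basis"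
  shows "(\<Sum>k\<in>Basis. g i k * h k j) = (if i = j then 1 else 0)"
    and "(\<Sum>k\<in>Basis. h i k * g k j) = (if i = j then 1 else 0)"
  using assms by (auto simp: inverse_pair_def)

text \<open>The resolvent identity \<open>h = h' - h (g - g') h'\<close>. With \<open>g = g'\<close>
  it gives uniqueness of the inverse; with \<open>g'\<close> the matrix at a fixed point it gives
  continuity and then the derivative of the inverse.\<close>

lemma inverse_pair_diff:
  assumes gh: "inverse_pair g h" "inverse_pair g' h'" and ij: "i \<in> Basis" "j \<in> Basis"
  shows "h i j = h' i j - (\<Sum>k\<in>Basis. \<Sum>l\<in>Basis. h i k * ((g k l - g' k l) * h' l j))"
proof -
  have "(\<Sum>k\<in>Basis. \<Sum>l\<in>Basis. h i k * (g k l * h' l j)) = (\<Sum>l\<in>Basis. (\<Sum>k\<in>Basis. h i k * g k l) * h' l j)"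
    by (subst sum.swap) (simp add: sum_distrib_right mult.assoc)
  also have "\<dots> = (\<Sum>l\<in>Basis. if i = l then h' l j else 0)"
    by (intro sum.cong refl) (simp add: inverse_pairD[OF gh(1) ij(1)])
  also have "\<dots> = h' i j" using ij by simp
  finally have 1: "(\<Sum>k\<in>Basis. \<Sum>l\<in>Basis. h i k * (g k l * h' l j)) = h' i j" .
  have "(\<Sum>k\<in>Basis. \<Sum>l\<in>Basis. h i k * (g' k l * h' l j)) = (\<Sum>k\<in>Basis. h i k * (\<Sum>l\<in>Basis. g' k l * h' l j))"
    by (simp add: sum_distrib_left)
  also have "\<dots> = (\<Sum>k\<in>Basis. if k = j then h i k else 0)"
    by (intro sum.cong refl) (simp add: inverse_pairD[OF gh(2) _ ij(2)])
  also have "\<dots> = h i j" using ij by simp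
  finally have 2: "(\<Sum>k\<in>Basis. \<Sum>l\<in>Basis. h i k * (g' k l * h' l j)) = h i j" .
  show ?thesis
    by (simp add: left_diff_distrib right_diff_distrib sum_subtractf 1 2)
qed

lemma inverse_on_Basis_eq:
  assumes "inverse_pair g h" "i \<in> Basis" "j \<in> Basis"
  shows "inverse_on_Basis g i j = h i j"
proof -
  have "inverse_pair g (inverse_on_Basis g)"
    unfolding inverse_on_Basis_def inverse_pair_def[symmetric] by (rule someI[of "inverse_pair g", OF assms(1)])
  from inverse_pair_diff[OF this assms] show ?thesis by simp
qed

text \<open>Positive definiteness makes the linear map with matrix \<open>g\<close> injective, hence
  bijective in finite dimension. The coordinates of the inverse map at basis vectors are the inverse
  matrix.\<close>

lemma pos_def_inverse_pair:
  fixes g :: "'a::euclidean_space \<Rightarrow> 'a \<Rightarrow> real"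
  assumes pd: "\<And>v. v \<noteq> 0 \<Longrightarrow> 0 < (\<Sum>i\<in>Basis. \<Sum>j\<in>Basis. g i j * (v \<bullet> i) * (v \<bullet> j))"
  shows "inverse_pair g (inverse_on_Basis g)"
proof -
  define G where "G v = (\<Sum>i\<in>Basis. (\<Sum>j\<in>Basis. g i j * (v \<bullet> j)) *\<^sub>R i)" for v :: 'a
  have Gi: "G v \<bullet> i = (\<Sum>j\<in>Basis. g i j * (v \<bullet> j))" if "i \<in> Basis" for v i
    unfolding G_def using that by simp
  have lin: "linear G"
    by (rule linearI)
      (auto simp: G_def inner_add_left ring_distribs sum.distrib scaleR_left_distrib
        scaleR_sum_right sum_distrib_left mult.left_commute)
  have "inj G"
  proof (rule linear_injective_0[OF lin, THEN iffD2], intro allI impI, rule ccontr)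
    fix v assume "G v = 0" "v \<noteq> 0"
    then have "(\<Sum>i\<in>Basis. (G v \<bullet> i) * (v \<bullet> i)) = 0" by simp
    with pd[OF \<open>v \<noteq> 0\<close>] show False by (simp add: Gi sum_distrib_left sum_distrib_right mult_ac)
  qed
  from linear_injective_isomorphism[OF lin this]
  obtain f where f: "linear f" "\<And>x. f (G x) = x" "\<And>x. G (f x) = x" by auto
  have "inverse_pair g (\<lambda>i j. f j \<bullet> i)"
    unfolding inverse_pair_def
  proof (intro ballI conjI)
    fix i j :: 'a assume ij: "i \<in> Basis" "j \<in> Basis"
    then show "(\<Sum>k\<in>Basis. g i k * (f j \<bullet> k)) = (if i = j then 1 else 0)"
      using Gi[of i "f j"] by (auto simp: f inner_Basis)
    have Gj: "G j = (\<Sum>k\<in>Basis. g k j *\<^sub>R k)"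
      unfolding G_def
      by (intro sum.cong refl arg_cong2[of _ _ _ _ scaleR])
        (use ij in \<open>simp add: inner_Basis if_distrib[of "\<lambda>x. _ * x"] cong: if_cong\<close>)
    have "(\<Sum>k\<in>Basis. (f k \<bullet> i) * g k j) = f (G j) \<bullet> i"
      by (simp add: Gj linear_sum[OF f(1)] linear_cmul[OF f(1)] inner_sum_left mult.commute)
    then show "(\<Sum>k\<in>Basis. (f k \<bullet> i) * g k j) = (if i = j then 1 else 0)"
      using ij by (simp add: f inner_Basis)
  qed
  then show ?thesis
    unfolding inverse_on_Basis_def inverse_pair_def[symmetric] by (rule someI[of "inverse_pair g"])
qed

text \<open>By the resolvent identity the change of \<open>h\<close> is at most the size
  \<open>m y\<close> of \<open>h y\<close>, times the change \<open>e y\<close> of \<open>g\<close>,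
  times \<open>m z\<close>. This helps only once \<open>m y\<close> is bounded near
  \<open>z\<close>, and that bound comes from the same estimate.\<close>

lemma isCont_inverse_pair:
  fixes g h :: "'b::real_normed_vector \<Rightarrow> 'a::euclidean_space \<Rightarrow> 'a \<Rightarrow> real"
  assumes S: "open S" "z \<in> S" and gh: "\<And>y. y \<in> S \<Longrightarrow> inverse_pair (g y) (h y)"
    and g: "\<And>i j. i \<in> Basis \<Longrightarrow> j \<in> Basis \<Longrightarrow> isCont (\<lambda>y. g y i j) z"
    and ij: "i \<in> Basis" "j \<in> Basis"
  shows "isCont (\<lambda>y. h y i j) z"
proof -
  define m where "m y = (\<Sum>i\<in>Basis. \<Sum>j\<in>Basis. \<bar>h y i j\<bar>)" for y
  define e where "e y = (\<Sum>i\<in>Basis. \<Sum>j\<in>Basis. \<bar>g y i j - g z i j\<bar>)" for y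
  \<comment> \<open>The number of matrix entries, which appears when the entrywise estimate is
    summed.\<close>
  define N where "N = real (DIM('a) * DIM('a))"
  have m: "\<bar>h y i j\<bar> \<le> m y" if "i \<in> Basis" "j \<in> Basis" for y i j
  proof -
    have "\<bar>h y i j\<bar> \<le> (\<Sum>j\<in>Basis. \<bar>h y i j\<bar>)" using that by (intro member_le_sum) auto
    also have "\<dots> \<le> m y" unfolding m_def using that
      by (intro member_le_sum[of i Basis "\<lambda>i. \<Sum>j\<in>Basis. \<bar>h y i j\<bar>"]) (auto intro: sum_nonneg)
    finally show ?thesis .
  qed
  have m0: "0 \<le> m y" for y unfolding m_def by (intro sum_nonneg) auto
  have le: "\<bar>h y i j - h z i j\<bar> \<le> m y * (e y * m z)" if "y \<in> S" "i \<in> Basis" "j \<in> Basis" for y i j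
  proof -
    have "\<bar>h y i j - h z i j\<bar> = \<bar>\<Sum>k\<in>Basis. \<Sum>l\<in>Basis. h y i k * ((g y k l - g z k l) * h z l j)\<bar>"
      using inverse_pair_diff[OF gh[OF that(1)] gh[OF S(2)] that(2,3)] by simp
    also have "\<dots> \<le> (\<Sum>k\<in>Basis. \<Sum>l\<in>Basis. \<bar>h y i k * ((g y k l - g z k l) * h z l j)\<bar>)"
      by (rule order_trans[OF sum_abs sum_mono[OF sum_abs]])
    also have "\<dots> \<le> (\<Sum>k\<in>Basis. \<Sum>l\<in>Basis. m y * (\<bar>g y k l - g z k l\<bar> * m z))"
      using that by (intro sum_mono) (auto simp: abs_mult intro!: mult_mono m m0)
    also have "\<dots> = m y * (e y * m z)" by (simp add: e_def sum_distrib_left sum_distrib_right)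
    finally show ?thesis .
  qed
  have "isCont e z" unfolding e_def by (intro continuous_intros g)
  moreover have "e z = 0" by (simp add: e_def)
  ultimately have e: "(e \<longlongrightarrow> 0) (at z)" by (simp add: isCont_def)
  then have "((\<lambda>y. N * (e y * m z)) \<longlongrightarrow> N * (0 * m z)) (at z)" by (intro tendsto_intros)
  \<comment> \<open>With the factor below 1/2, half of \<open>m y\<close> is absorbed on the left of
    \<open>m y \<le> m z + m y * (N * (e y * m z))\<close>, which leaves
    \<open>m y \<le> 2 * m z\<close>.\<close>
  then have "\<forall>\<^sub>F y in at z. N * (e y * m z) < 1/2"
    by (rule order_tendstoD) simp
  moreover have inS: "\<forall>\<^sub>F y in at z. y \<in> S" using S by (rule eventually_at_in_open')
  ultimately have bnd: "\<forall>\<^sub>F y in at z. \<bar>h y i j - h z i j\<bar> \<le> 2 * m z * (e y * m z)"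
  proof eventually_elim
    case (elim y)
    have e0: "0 \<le> e y" unfolding e_def by (intro sum_nonneg) auto
    have "\<bar>h y i j\<bar> \<le> \<bar>h z i j\<bar> + m y * (e y * m z)" if "i \<in> Basis" "j \<in> Basis" for i j
      using le[OF elim(2) that] by linarith
    then have "(\<Sum>i\<in>Basis. \<Sum>j\<in>Basis. \<bar>h y i j\<bar>) \<le> (\<Sum>i\<in>Basis. \<Sum>j\<in>Basis. \<bar>h z i j\<bar> + m y * (e y * m z))"
      by (intro sum_mono)
    then have "m y \<le> (\<Sum>i\<in>Basis. \<Sum>j\<in>Basis. \<bar>h z i j\<bar> + m y * (e y * m z))"
      by (simp only: m_def[of y, symmetric])
    also have "\<dots> = m z + m y * (N * (e y * m z))"
      by (simp add: m_def[of z] N_def sum.distrib)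
    also have "\<dots> \<le> m z + m y * (1/2)" using elim m0 by (intro add_left_mono mult_left_mono) auto
    finally have "m y \<le> 2 * m z" by simp
    then have "m y * (e y * m z) \<le> 2 * m z * (e y * m z)"
      by (intro mult_right_mono) (simp_all add: m0 e0)
    with le[OF elim(2) ij] show ?case by linarith
  qed
  have "((\<lambda>y. 2 * m z * (e y * m z)) \<longlongrightarrow> 2 * m z * (0 * m z)) (at z)" by (intro tendsto_intros e)
  then have "((\<lambda>y. 2 * m z * (e y * m z)) \<longlongrightarrow> 0) (at z)" by simp
  with bnd have "((\<lambda>y. h y i j - h z i j) \<longlongrightarrow> 0) (at z)"
    by (intro Lim_null_comparison[of "\<lambda>y. h y i j - h z i j"]) simp_all
  then show ?thesis by (simp add: isCont_def LIM_zero_iff)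
qed

text \<open>A product rule in which \<open>c\<close> is merely continuous: since \<open>d\<close>
  vanishes at \<open>z\<close>, the error \<open>(c y - c z) * d y\<close> is of smaller order than
  \<open>norm (y - z)\<close>. It is made for the resolvent identity, where the inverse whose
  derivative is sought is itself a factor.\<close>

lemma has_derivative_mult_isCont:
  fixes c d :: "'b::real_normed_vector \<Rightarrow> real"
  assumes c: "isCont c z" and d: "(d has_derivative d') (at z)" and z: "d z = 0"
  shows "((\<lambda>y. c y * d y) has_derivative (\<lambda>v. c z * d' v)) (at z)"
proof -
  from d have bl: "bounded_linear d'" by (rule has_derivative_bounded_linear)
  then obtain K where K: "K > 0" "\<And>v. \<bar>d' v\<bar> \<le> norm v * K"
    using bounded_linear.pos_bounded by (metis real_norm_def)
  have d1: "\<exists>r>0. \<forall>y. norm (y - z) < r \<longrightarrow> \<bar>d y - d' (y - z)\<bar> \<le> e * norm (y - z)" if "e > 0" for e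
    using d that z by (auto simp: has_derivative_at_alt)
  have "((\<lambda>y. (c y - c z) * d y) has_derivative (\<lambda>v. 0)) (at z)"
    unfolding has_derivative_at_alt
  proof (intro conjI allI impI)
    fix e :: real assume "e > 0"
    obtain r where r: "r > 0" "\<And>y. norm (y - z) < r \<Longrightarrow> \<bar>d y - d' (y - z)\<bar> \<le> 1 * norm (y - z)"
      using d1[of 1] by auto
    \<comment> \<open>The tolerance matches
      \<open>\<bar>d y\<bar> \<le> (K + 1) * norm (y - z)\<close>: \<open>K\<close> bounds
      \<open>d'\<close>, and the 1 is the remainder permitted by \<open>r\<close>.\<close>
    obtain s where s: "s > 0" "\<And>y. norm (y - z) < s \<Longrightarrow> \<bar>c y - c z\<bar> < e / (K + 1)"
      using c \<open>e > 0\<close> K(1) unfolding continuous_at_eps_delta dist_norm real_norm_def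
      by (metis add_pos_pos divide_pos_pos zero_less_one)
    show "\<exists>q>0. \<forall>y. norm (y - z) < q \<longrightarrow>
        norm ((c y - c z) * d y - (c z - c z) * d z - 0) \<le> e * norm (y - z)"
    proof (intro exI[of _ "min r s"] conjI allI impI)
      fix y assume y: "norm (y - z) < min r s"
      have "\<bar>d y\<bar> \<le> (K + 1) * norm (y - z)"
        using r(2)[of y] K(2)[of "y - z"] y by (auto simp: algebra_simps)
      moreover have "\<bar>c y - c z\<bar> \<le> e / (K + 1)" using s(2)[of y] y by auto
      ultimately have "\<bar>c y - c z\<bar> * \<bar>d y\<bar> \<le> e / (K + 1) * ((K + 1) * norm (y - z))"
        by (intro mult_mono) (use \<open>e > 0\<close> K(1) in auto)
      then show "norm ((c y - c z) * d y - (c z - c z) * d z - 0) \<le> e * norm (y - z)"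
        using K(1) by (simp add: abs_mult)
    qed (use r s in auto)
  qed simp
  from has_derivative_add[OF this has_derivative_mult_right[OF d, of "c z"]]
  show ?thesis by (simp add: algebra_simps)
qed

text \<open>Freeze the second pair of the resolvent identity at \<open>z\<close>. The factor
  \<open>g y - g z\<close> vanishes at \<open>z\<close> and \<open>h y\<close> is continuous there,
  so the derivative is \<open>- h g' h\<close>.\<close>

lemma has_derivative_inverse_pair:
  fixes g h :: "'b::real_normed_vector \<Rightarrow> 'a::euclidean_space \<Rightarrow> 'a \<Rightarrow> real"
  assumes S: "open S" "z \<in> S" and gh: "\<And>y. y \<in> S \<Longrightarrow> inverse_pair (g y) (h y)"
    and g: "\<And>i j. i \<in> Basis \<Longrightarrow> j \<in> Basis \<Longrightarrow> ((\<lambda>y. g y i j) has_derivative g' i j) (at z)"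
    and ij: "i \<in> Basis" "j \<in> Basis"
  shows "((\<lambda>y. h y i j) has_derivative
    (\<lambda>v. \<Sum>k\<in>Basis. \<Sum>l\<in>Basis. (- 1) * (h z i k * (g' k l v * h z l j)))) (at z)"
proof -
  have "((\<lambda>y. h z i j + (\<Sum>k\<in>Basis. \<Sum>l\<in>Basis. (- 1) * (h y i k * ((g y k l - g z k l) * h z l j))))
     has_derivative (\<lambda>v. 0 + (\<Sum>k\<in>Basis. \<Sum>l\<in>Basis. (- 1) * (h z i k * (g' k l v * h z l j))))) (at z)"
  proof (intro has_derivative_add has_derivative_const has_derivative_sum has_derivative_mult_right
      has_derivative_mult_isCont isCont_inverse_pair[OF S gh] ij)
    fix k l :: 'a assume "k \<in> Basis" "l \<in> Basis"
    from has_derivative_mult_left[OF has_derivative_diff[OF g[OF this] has_derivative_const]]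
    show "((\<lambda>y. (g y k l - g z k l) * h z l j) has_derivative (\<lambda>v. g' k l v * h z l j)) (at z)"
      by simp
  qed (auto intro: has_derivative_continuous g)
  then have "((\<lambda>y. h z i j + (\<Sum>k\<in>Basis. \<Sum>l\<in>Basis. (- 1) * (h y i k * ((g y k l - g z k l) * h z l j))))
     has_derivative (\<lambda>v. \<Sum>k\<in>Basis. \<Sum>l\<in>Basis. (- 1) * (h z i k * (g' k l v * h z l j)))) (at z)"
    by (simp only: add_0_left)
  then show ?thesis
  proof (rule has_derivative_transform_within_open[OF _ S])
    fix y assume "y \<in> S"
    from inverse_pair_diff[OF gh[OF this] gh[OF S(2)] ij]
    show "h z i j + (\<Sum>k\<in>Basis. \<Sum>l\<in>Basis. (- 1) * (h y i k * ((g y k l - g z k l) * h z l j))) = h y i j"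
      by (simp add: sum_negf)
  qed
qed

text \<open>Bootstrapping: the derivative of \<open>h\<close> is a polynomial in \<open>h\<close>
  and the derivative of \<open>g\<close>, so \<open>h\<close> of class \<open>k\<close> implies
  \<open>h\<close> of class \<open>Suc k\<close>.\<close>

lemma smooth_on_inverse_pair:
  fixes g h :: "'b::real_normed_vector \<Rightarrow> 'a::euclidean_space \<Rightarrow> 'a \<Rightarrow> real"
  assumes S: "open S" and gh: "\<And>y. y \<in> S \<Longrightarrow> inverse_pair (g y) (h y)"
    and g: "\<And>i j. i \<in> Basis \<Longrightarrow> j \<in> Basis \<Longrightarrow> smooth_on S (\<lambda>y. g y i j)"
    and ij: "i \<in> Basis" "j \<in> Basis"
  shows "smooth_on S (\<lambda>y. h y i j)"
proof -
  note d = has_derivative_inverse_pair[OF S _ gh smooth_on_has_derivative[OF g]]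
  have Ck_sum: "Ck_on k S (\<lambda>x. \<Sum>i\<in>I. f i x)" if "\<And>i. i \<in> I \<Longrightarrow> Ck_on k S (f i)" "finite I"
    for k and I :: "'a set" and f :: "'a \<Rightarrow> 'b \<Rightarrow> real"
    using that(2,1) by (induction I) (auto simp: Ck_on_const intro!: Ck_on_add[OF S])
  have "Ck_on k S (\<lambda>y. h y i j)" if "i \<in> Basis" "j \<in> Basis" for i j k
    using that
  proof (induction k arbitrary: i j)
    case 0
    then show ?case
      using d by (auto intro!: continuous_at_imp_continuous_on has_derivative_continuous)
  next
    case (Suc k)
    have g': "Ck_on k S (\<lambda>z. frechet_derivative (\<lambda>y. g y i j) (at z) v)"
      if "i \<in> Basis" "j \<in> Basis" for i j v
      using smooth_on_frechet[OF g[OF that]] unfolding smooth_on_def by blast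
    show ?case
    proof (rule Ck_on_SucI[OF S d])
      show "Ck_on k S (\<lambda>z. \<Sum>ka\<in>Basis. \<Sum>l\<in>Basis.
          (- 1) * (h z i ka * (frechet_derivative (\<lambda>y. g y ka l) (at z) v * h z l j)))" for v
        by (intro Ck_sum Ck_on_mult[OF S] Ck_on_const Suc g' finite_Basis)
    qed (use Suc.prems in auto)
  qed
  then show ?thesis using ij by (simp add: smooth_on_def)
qed

section \<open>Finsler functions in coordinates\<close>

text \<open>Euler's relation, from differentiating \<open>f ((1 + t) y) = (1 + t) ^ n * f y\<close>
  at \<open>t = 0\<close>. Homogeneity is positive only, whence the restriction to
  \<open>t > -1\<close>.\<close>

lemma euler_homogeneous:
  fixes f :: "'a::euclidean_space \<Rightarrow> real"
  assumes f: "smooth_on S f" "y \<in> S" and hom: "\<And>t. t > 0 \<Longrightarrow> f (t *\<^sub>R y) = t ^ n * f y"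
  shows "(\<Sum>i\<in>Basis. (y \<bullet> i) * dirderiv i f y) = n * f y"
proof -
  have "\<forall>\<^sub>F t in nhds (0::real). t \<in> {-1<..}"
    by (rule eventually_nhds_in_open) auto
  then have "\<forall>\<^sub>F t in nhds 0. f (y + t *\<^sub>R y) = (1 + t) ^ n * f y"
  proof eventually_elim
    case (elim t)
    then show ?case using hom[of "1 + t"] by (simp add: scaleR_left_distrib)
  qed
  then have "dirderiv y f y = deriv (\<lambda>t. (1 + t) ^ n * f y) 0"
    unfolding dirderiv_def by (rule deriv_cong_ev) simp
  also have "\<dots> = n * f y"
    by (rule DERIV_imp_deriv) (auto intro!: derivative_eq_intros)
  finally show ?thesis
    using frechet_derivative_Basis_sum[OF f, of y] f by (simp add: smooth_on_dirderiv_eq)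
qed

text \<open>A Finsler metric as seen in one chart with range \<open>X\<close>, detached from the
  manifold.\<close>

locale finsler_function =
  fixes X :: "'a::euclidean_space set" and H :: "'a \<Rightarrow> 'a \<Rightarrow> real"
  assumes open_X: "open X"
    and smooth: "smooth_on (X \<times> (UNIV - {0})) (\<lambda>(x, y). H x y)"
    and homogeneous: "\<And>x y r. x \<in> X \<Longrightarrow> y \<noteq> 0 \<Longrightarrow> r > 0 \<Longrightarrow> H x (r *\<^sub>R y) = r * H x y"
    and pos_def: "\<And>x y v. x \<in> X \<Longrightarrow> y \<noteq> 0 \<Longrightarrow> v \<noteq> 0 \<Longrightarrow>
      0 < (\<Sum>i\<in>Basis. \<Sum>j\<in>Basis. fund H i j x y * (v \<bullet> i) * (v \<bullet> j))"
begin

lemma open_slit: "open (UNIV - {0 :: 'a})"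
  by (intro open_Diff open_UNIV closed_singleton)

lemma smooth_sq: "smooth_on (X \<times> (UNIV - {0})) (\<lambda>(x, y). sq H x y)"
proof -
  have o: "open (X \<times> (UNIV - {0 :: 'a}))" by (intro open_Times open_X open_slit)
  show ?thesis
    by (rule smooth_on_cong[OF o smooth_on_mult[OF o smooth smooth]])
      (auto simp: sq_def power2_eq_square)
qed

lemmas smooth_dy_sq = smooth_on_partial_snd[OF smooth_sq open_X open_slit, folded dy_eq]
lemmas smooth_dy_dy_sq = smooth_on_partial_snd[OF smooth_dy_sq open_X open_slit, folded dy_eq]
lemmas smooth_dx_sq = smooth_on_partial_fst[OF smooth_sq open_X open_slit, folded dx_eq]
lemmas smooth_dx_dy_sq = smooth_on_partial_fst[OF smooth_dy_sq open_X open_slit, folded dx_eq]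

lemmas slice = smooth_on_slice[OF _ open_X open_slit]
lemmas slice_fst = smooth_on_slice_fst[OF _ open_X open_slit]

lemma smooth_fund: "x \<in> X \<Longrightarrow> smooth_on (UNIV - {0}) (fund H i j x)"
  unfolding fund_def[abs_def]
  by (intro smooth_on_mult smooth_on_const open_slit slice[OF smooth_dy_dy_sq])

lemma fund_inverse_pair:
  "x \<in> X \<Longrightarrow> y \<noteq> 0 \<Longrightarrow> inverse_pair (\<lambda>k l. fund H k l x y) (\<lambda>k l. fund_inv H k l x y)"
  unfolding fund_inv_def by (rule pos_def_inverse_pair) (rule pos_def)

lemma smooth_fund_inv:
  assumes "x \<in> X" "i \<in> Basis" "j \<in> Basis"
  shows "smooth_on (UNIV - {0}) (fund_inv H i j x)"
  by (rule smooth_on_inverse_pair[OF open_slit _ smooth_fund[OF assms(1)] assms(2,3)])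
    (rule fund_inverse_pair[OF assms(1)], simp)

lemma smooth_inner: "smooth_on (UNIV - {0}) (\<lambda>y. y \<bullet> (k :: 'a))"
  by (intro smooth_on_linear bounded_linear_inner_left open_slit)

lemma smooth_spray:
  assumes "x \<in> X" "l \<in> Basis"
  shows "smooth_on (UNIV - {0}) (spray H l x)"
  unfolding spray_def[abs_def]
  by (intro smooth_on_mult smooth_on_const smooth_on_sum smooth_on_diff open_slit smooth_inner
      smooth_fund_inv slice[OF smooth_dx_dy_sq] slice[OF smooth_dx_sq] assms)

lemma sq_homogeneous:
  "x \<in> X \<Longrightarrow> y \<noteq> 0 \<Longrightarrow> t > 0 \<Longrightarrow> sq H x (t *\<^sub>R y) = t\<^sup>2 * sq H x y"
  by (simp add: sq_def homogeneous power_mult_distrib)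

lemma dy_sq_homogeneous:
  assumes "x \<in> X" "y \<noteq> 0" "t > 0"
  shows "dy j (sq H) x (t *\<^sub>R y) = t * dy j (sq H) x y"
proof -
  have "dy j (sq H) x (t *\<^sub>R y) = t ^ 1 * dy j (sq H) x y"
    unfolding dy_eq
    by (rule dirderiv_homogeneous[OF _ open_slit slice[OF smooth_sq]])
      (use assms in \<open>auto simp: sq_homogeneous power2_eq_square\<close>)
  then show ?thesis by simp
qed

lemma fund_homogeneous:
  assumes "x \<in> X" "y \<noteq> 0" "t > 0"
  shows "fund H i j x (t *\<^sub>R y) = fund H i j x y"
proof -
  have "dy i (dy j (sq H)) x (t *\<^sub>R y) = t ^ 0 * dy i (dy j (sq H)) x y"
    unfolding dy_eq[of i]
    by (rule dirderiv_homogeneous[OF _ open_slit slice[OF smooth_dy_sq]])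
      (use assms in \<open>auto simp: dy_sq_homogeneous\<close>)
  then show ?thesis by (simp add: fund_def)
qed

lemma fund_inv_homogeneous:
  assumes "x \<in> X" "y \<noteq> 0" "t > 0"
  shows "fund_inv H i j x (t *\<^sub>R y) = fund_inv H i j x y"
  by (simp add: fund_inv_def fund_homogeneous[OF assms])

lemma y_lower_homogeneous:
  assumes "x \<in> X" "y \<noteq> 0" "t > 0"
  shows "y_lower H l x (t *\<^sub>R y) = t * y_lower H l x y"
  by (simp add: y_lower_def fund_homogeneous[OF assms] sum_distrib_left mult_ac)

text \<open>Euler's relation applied twice gives \<open>g\<^sub>i\<^sub>j y\<^sup>i y\<^sup>j = F\<^sup>2\<close>.\<close>

lemma sq_pos:
  assumes x: "x \<in> X" and y: "y \<noteq> 0"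
  shows "0 < sq H x y"
proof -
  have 1: "(\<Sum>j\<in>Basis. (y \<bullet> j) * dy j (sq H) x y) = 2 * sq H x y"
    unfolding dy_eq
    using euler_homogeneous[OF slice[OF smooth_sq x], where y = y and n = 2] sq_homogeneous[OF x] y by simp
  have 2: "(\<Sum>i\<in>Basis. (y \<bullet> i) * dy i (dy j (sq H)) x y) = dy j (sq H) x y" for j
    unfolding dy_eq[of _ "dy j (sq H)"]
    using euler_homogeneous[OF slice[OF smooth_dy_sq x], where y = y and n = 1] dy_sq_homogeneous[OF x] y by simp
  have "(\<Sum>i\<in>Basis. \<Sum>j\<in>Basis. fund H i j x y * (y \<bullet> i) * (y \<bullet> j)) =
      1/2 * (\<Sum>j\<in>Basis. (y \<bullet> j) * (\<Sum>i\<in>Basis. (y \<bullet> i) * dy i (dy j (sq H)) x y))"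
    by (subst sum.swap) (simp add: fund_def sum_distrib_left mult_ac)
  also have "\<dots> = sq H x y" by (simp add: 1 2)
  finally show ?thesis using pos_def[OF x y y] by simp
qed

end

section \<open>Doubly warped products in coordinates\<close>

text \<open>
  The splitting of the coordinate space into two blocks is kept symmetric, so that every
  statement on the first block also holds for the second one.
\<close>

locale two_blocks =
  fixes i1 :: "'a::euclidean_space \<Rightarrow> 'c::euclidean_space" and i2 :: "'b::euclidean_space \<Rightarrow> 'c"
    and p1 :: "'c \<Rightarrow> 'a" and p2 :: "'c \<Rightarrow> 'b"
  assumes linear: "linear i1" "linear i2" "linear p1" "linear p2"
    and proj [simp]: "p1 (i1 a) = a" "p2 (i2 b) = b" "p1 (i2 b) = 0" "p2 (i1 a) = 0"
    and split [simp]: "i1 (p1 z) + i2 (p2 z) = z"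
    and Basis_eq: "Basis = i1 ` Basis \<union> i2 ` Basis"
    and inner [simp]: "z \<bullet> i1 a = p1 z \<bullet> a" "z \<bullet> i2 b = p2 z \<bullet> b"
begin

lemma proj_add [simp]: "p1 (z + w) = p1 z + p1 w" "p2 (z + w) = p2 z + p2 w"
  by (simp_all add: linear linear_add)

lemma proj_scaleR [simp]: "p1 (t *\<^sub>R z) = t *\<^sub>R p1 z" "p2 (t *\<^sub>R z) = t *\<^sub>R p2 z"
  by (simp_all add: linear linear_cmul)

lemma Basis_I [simp]: "a \<in> Basis \<Longrightarrow> i1 a \<in> Basis" "b \<in> Basis \<Longrightarrow> i2 b \<in> Basis"
  by (auto simp: Basis_eq)

lemma sum_Basis: "(\<Sum>k\<in>Basis. f k) = (\<Sum>k\<in>Basis. f (i1 k)) + (\<Sum>k\<in>Basis. f (i2 k))"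
proof -
  have "inj_on i1 Basis" "inj_on i2 Basis" by (metis proj(1) inj_onI) (metis proj(2) inj_onI)
  moreover have "i1 ` Basis \<inter> i2 ` Basis = {}" by (auto dest: arg_cong[of _ _ p1])
  ultimately show ?thesis
    unfolding Basis_eq by (subst sum.union_disjoint) (auto simp: sum.reindex)
qed

lemma dirderiv_block:
  "dirderiv (i1 a) f y = dirderiv a (\<lambda>z. f (i1 z + i2 (p2 y))) (p1 y)"
proof -
  have "y + t *\<^sub>R i1 a = i1 (p1 y + t *\<^sub>R a) + i2 (p2 y)" for t
    using split[of y] linear(1) by (simp add: linear_add linear_cmul add_ac)
  then show ?thesis by (simp add: dirderiv_def)
qed

text \<open>The second component is frozen through all three derivatives, so every factor that
  depends on it alone behaves as a constant.\<close>

lemma dy_dy_dy_block: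
  "dy (i1 i) (dy (i1 j) (dy (i1 k) G)) x y =
    dirderiv i (dirderiv j (dirderiv k (\<lambda>z. G x (i1 z + i2 (p2 y))))) (p1 y)"
  by (simp add: dy_eq dirderiv_block[abs_def])

end

section \<open>Fundamental tensor and spray of the warped product in coordinates\<close>

definition warp_deriv :: "('a::euclidean_space \<Rightarrow> real) \<Rightarrow> 'a \<Rightarrow> 'a \<Rightarrow> real" where
  "warp_deriv U x y = (\<Sum>k\<in>Basis. (y \<bullet> k) * dirderiv k U x)"

text \<open>For a Finsler function Euler's relation identifies this with twice the component of
  \<open>y\<close> with index \<open>l\<close>. It enters below through its smoothness and its
  degree 1 in \<open>y\<close>.\<close>

definition raised_dy :: "('a::euclidean_space \<Rightarrow> 'a \<Rightarrow> real) \<Rightarrow> 'a \<Rightarrow> 'a \<Rightarrow> 'a \<Rightarrow> real" where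
  "raised_dy H l x y = (\<Sum>m\<in>Basis. fund_inv H l m x y * dy m (sq H) x y)"

text \<open>The gradient of \<open>U\<close> with respect to the fundamental tensor at
  \<open>(x, y)\<close>, of degree 0 in \<open>y\<close>.\<close>

definition raised_grad ::
  "('a::euclidean_space \<Rightarrow> 'a \<Rightarrow> real) \<Rightarrow> ('a \<Rightarrow> real) \<Rightarrow> 'a \<Rightarrow> 'a \<Rightarrow> 'a \<Rightarrow> real" where
  "raised_grad H U l x y = (\<Sum>m\<in>Basis. fund_inv H l m x y * dirderiv m U x)"

lemma warp_deriv_scaleR: "warp_deriv U x (t *\<^sub>R y) = t * warp_deriv U x y"
  by (simp add: warp_deriv_def sum_distrib_left mult_ac)

lemma (in finsler_function) smooth_raised:
  assumes "x \<in> X" "l \<in> Basis"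
  shows "smooth_on (UNIV - {0}) (raised_dy H l x)" "smooth_on (UNIV - {0}) (raised_grad H U l x)"
    "smooth_on (UNIV - {0}) (warp_deriv U x)"
proof -
  note intros = smooth_on_mult smooth_on_const smooth_on_sum open_slit smooth_inner
    smooth_fund_inv slice[OF smooth_dy_sq] assms
  show "smooth_on (UNIV - {0}) (raised_dy H l x)"
    unfolding raised_dy_def[abs_def] by (intro intros)
  show "smooth_on (UNIV - {0}) (raised_grad H U l x)"
    unfolding raised_grad_def[abs_def] by (intro intros)
  show "smooth_on (UNIV - {0}) (warp_deriv U x)"
    unfolding warp_deriv_def[abs_def] by (intro intros)
qed

lemma (in finsler_function) raised_homogeneous:
  assumes "x \<in> X" "y \<noteq> 0" "t > 0"
  shows "raised_dy H l x (t *\<^sub>R y) = t * raised_dy H l x y"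
    "raised_grad H U l x (t *\<^sub>R y) = raised_grad H U l x y"
  by (simp_all add: raised_dy_def raised_grad_def fund_inv_homogeneous[OF assms]
      dy_sq_homogeneous[OF assms] sum_distrib_left mult_ac)

text \<open>\<open>U1\<close> and \<open>U2\<close> stand for the squared warping functions. The
  metric enters through its square, and \<open>H_nonneg\<close> allows \<open>H\<close> to be
  recovered as a square root.\<close>

locale warped_blocks =
  two_blocks i1 i2 p1 p2 + M1: finsler_function X1 H1 + M2: finsler_function X2 H2
  for i1 :: "'a::euclidean_space \<Rightarrow> 'c::euclidean_space" and i2 :: "'b::euclidean_space \<Rightarrow> 'c"
    and p1 p2 X1 X2 H1 H2 +
  fixes H :: "'c \<Rightarrow> 'c \<Rightarrow> real" and U1 :: "'a \<Rightarrow> real" and U2 :: "'b \<Rightarrow> real"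
  assumes smooth_U: "smooth_on X1 U1" "smooth_on X2 U2"
    and U_pos: "\<And>x. x \<in> X1 \<Longrightarrow> 0 < U1 x" "\<And>x. x \<in> X2 \<Longrightarrow> 0 < U2 x"
    and H_nonneg: "\<And>x y. p1 x \<in> X1 \<Longrightarrow> p2 x \<in> X2 \<Longrightarrow> 0 \<le> H x y"
    and sq_H: "\<And>x y. p1 x \<in> X1 \<Longrightarrow> p2 x \<in> X2 \<Longrightarrow>
      sq H x y = U2 (p2 x) * sq H1 (p1 x) (p1 y) + U1 (p1 x) * sq H2 (p2 x) (p2 y)"
begin

lemma swap: "warped_blocks i2 i1 p2 p1 X2 X1 H2 H1 H U2 U1"
proof -
  have "two_blocks i2 i1 p2 p1"
  proof (rule two_blocks.intro)
    show "i2 (p2 z) + i1 (p1 z) = z" for z using split by (subst add.commute)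
    show "Basis = i2 ` Basis \<union> i1 ` Basis" using Basis_eq by (subst Un_commute)
  qed (rule linear proj inner)+
  then show ?thesis
  proof (intro warped_blocks.intro warped_blocks_axioms.intro)
    show "sq H x y = U1 (p1 x) * sq H2 (p2 x) (p2 y) + U2 (p2 x) * sq H1 (p1 x) (p1 y)"
      if "p2 x \<in> X2" "p1 x \<in> X1" for x y
      using sq_H[OF that(2,1)] by simp
  qed (use smooth_U U_pos H_nonneg M1.finsler_function_axioms M2.finsler_function_axioms in blast)+
qed

lemma dy_sq_H:
  assumes x: "p1 x \<in> X1" "p2 x \<in> X2" and y: "p1 y \<noteq> 0" "p2 y \<noteq> 0"
  shows "dy (i1 l) (sq H) x y = U2 (p2 x) * dy l (sq H1) (p1 x) (p1 y)"
proof -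
  have s: "smooth_on (UNIV - {0}) (sq H1 (p1 x))" using M1.slice[OF M1.smooth_sq] assms by simp
  show ?thesis
    unfolding dy_eq dirderiv_block
    using dirderiv_cmult_add[OF s smooth_on_const, of "p1 y" l "U2 (p2 x)" "U1 (p1 x) * sq H2 (p2 x) (p2 y)" 1] assms
    by (simp add: sq_H dirderiv_const)
qed

lemma fund_H:
  assumes x: "p1 x \<in> X1" "p2 x \<in> X2" and y: "p1 y \<noteq> 0" "p2 y \<noteq> 0"
  shows "fund H (i1 i) (i1 j) x y = U2 (p2 x) * fund H1 i j (p1 x) (p1 y)"
proof -
  have "dy (i1 i) (dy (i1 j) (sq H)) x y
      = dirderiv i (\<lambda>z. U2 (p2 x) * dy j (sq H1) (p1 x) z) (p1 y)"
    unfolding dy_eq[of "i1 i"] dirderiv_block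
    by (rule dirderiv_cong[OF M1.open_slit]) (use assms in \<open>auto simp: dy_sq_H\<close>)
  also have "\<dots> = U2 (p2 x) * dirderiv i (dy j (sq H1) (p1 x)) (p1 y)"
    by (rule dirderiv_cmult[OF M1.slice[OF M1.smooth_dy_sq]]) (use assms in auto)
  finally show ?thesis by (simp add: fund_def dy_eq)
qed

lemma fund_H_mixed:
  assumes x: "p1 x \<in> X1" "p2 x \<in> X2" and y: "p1 y \<noteq> 0" "p2 y \<noteq> 0"
  shows "fund H (i1 i) (i2 j) x y = 0"
proof -
  have "dy (i1 i) (dy (i2 j) (sq H)) x y
      = dirderiv i (\<lambda>z. U1 (p1 x) * dy j (sq H2) (p2 x) (p2 y)) (p1 y)"
    unfolding dy_eq[of "i1 i"] dirderiv_block
    by (rule dirderiv_cong[OF M1.open_slit])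
      (use assms in \<open>auto simp: warped_blocks.dy_sq_H[OF swap]\<close>)
  then show ?thesis by (simp add: fund_def dirderiv_const)
qed

lemma fund_H_all:
  assumes x: "p1 x \<in> X1" "p2 x \<in> X2" and y: "p1 y \<noteq> 0" "p2 y \<noteq> 0"
  shows "fund H (i1 i) (i1 j) x y = U2 (p2 x) * fund H1 i j (p1 x) (p1 y)"
    and "fund H (i2 k) (i2 l) x y = U1 (p1 x) * fund H2 k l (p2 x) (p2 y)"
    and "fund H (i1 i) (i2 l) x y = 0" and "fund H (i2 l) (i1 i) x y = 0"
  using fund_H fund_H_mixed warped_blocks.fund_H[OF swap] warped_blocks.fund_H_mixed[OF swap] assms
  by simp_all

text \<open>A block diagonal candidate is checked to be an inverse, and uniqueness of inverses
  identifies it with \<open>fund_inv\<close>.\<close>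

lemma fund_inv_H:
  assumes x: "p1 x \<in> X1" "p2 x \<in> X2" and y: "p1 y \<noteq> 0" "p2 y \<noteq> 0" and i: "i \<in> Basis"
  shows "j \<in> Basis \<Longrightarrow> fund_inv H (i1 i) (i1 j) x y = fund_inv H1 i j (p1 x) (p1 y) / U2 (p2 x)"
    and "k \<in> Basis \<Longrightarrow> fund_inv H (i1 i) (i2 k) x y = 0"
proof -
  \<comment> \<open>Indices are vectors, so the block of an index is read off from which of its
    projections vanishes.\<close>
  define h where "h I J = (if p2 I = 0 \<and> p2 J = 0 then fund_inv H1 (p1 I) (p1 J) (p1 x) (p1 y) / U2 (p2 x)
    else if p1 I = 0 \<and> p1 J = 0 then fund_inv H2 (p2 I) (p2 J) (p2 x) (p2 y) / U1 (p1 x) else 0)" for I J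
  have h: "h (i1 a) (i1 b) = fund_inv H1 a b (p1 x) (p1 y) / U2 (p2 x)" for a b
    by (simp add: h_def)
  have h2: "h (i2 a) (i2 b) = fund_inv H2 a b (p2 x) (p2 y) / U1 (p1 x)"
    if "a \<in> Basis" "b \<in> Basis" for a b
    using that by (auto simp: h_def dest: nonzero_Basis)
  have h12: "h (i1 a) (i2 b) = 0" "h (i2 b) (i1 a) = 0" if "a \<in> Basis" "b \<in> Basis" for a b
    using that by (auto simp: h_def dest: nonzero_Basis)
  have U: "U1 (p1 x) \<noteq> 0" "U2 (p2 x) \<noteq> 0" using U_pos(1)[OF x(1)] U_pos(2)[OF x(2)] by auto
  have i12: "i1 a \<noteq> i2 b" "i2 b \<noteq> i1 a" if "a \<in> Basis" for a b
    using that by (metis proj(1,3) nonzero_Basis)+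
  have i11: "i1 a = i1 a' \<longleftrightarrow> a = a'" "i2 b = i2 b' \<longleftrightarrow> b = b'" for a a' b b'
    by (metis proj(1)) (metis proj(2))
  have "inverse_pair (\<lambda>k l. fund H k l x y) h"
    unfolding inverse_pair_def sum_Basis unfolding Basis_eq ball_Un ball_simps
    by (auto simp: fund_H_all[OF x y] h h2 h12 i12 i11 U
        M1.fund_inverse_pair[OF x(1) y(1), THEN inverse_pairD(1)]
        M2.fund_inverse_pair[OF x(2) y(2), THEN inverse_pairD(1)]
        M1.fund_inverse_pair[OF x(1) y(1), THEN inverse_pairD(2)]
        M2.fund_inverse_pair[OF x(2) y(2), THEN inverse_pairD(2)])
  note eq = inverse_on_Basis_eq[OF this, folded fund_inv_def]
  show "j \<in> Basis \<Longrightarrow> fund_inv H (i1 i) (i1 j) x y = fund_inv H1 i j (p1 x) (p1 y) / U2 (p2 x)"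
    using i by (simp add: eq h)
  show "k \<in> Basis \<Longrightarrow> fund_inv H (i1 i) (i2 k) x y = 0"
    using i by (simp add: eq h12)
qed

lemma y_lower_H:
  assumes x: "p1 x \<in> X1" "p2 x \<in> X2" and y: "p1 y \<noteq> 0" "p2 y \<noteq> 0"
  shows "y_lower H (i1 l) x y = U2 (p2 x) * y_lower H1 l (p1 x) (p1 y)"
  by (simp add: y_lower_def sum_Basis fund_H_all[OF assms] sum_distrib_left mult_ac)

lemma dx_dy_sq_H:
  assumes x: "p1 x \<in> X1" "p2 x \<in> X2" and y: "p1 y \<noteq> 0" "p2 y \<noteq> 0"
  shows "dx (i1 k) (dy (i1 l) (sq H)) x y = U2 (p2 x) * dx k (dy l (sq H1)) (p1 x) (p1 y)"
proof -
  have "dx (i1 k) (dy (i1 l) (sq H)) x y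
      = dirderiv k (\<lambda>z. U2 (p2 x) * dy l (sq H1) z (p1 y)) (p1 x)"
    unfolding dx_eq dirderiv_block
    by (rule dirderiv_cong[OF M1.open_X]) (use assms in \<open>auto simp: dy_sq_H\<close>)
  also have "\<dots> = U2 (p2 x) * dx k (dy l (sq H1)) (p1 x) (p1 y)"
    unfolding dx_eq
    by (rule dirderiv_cmult[OF M1.slice_fst[OF M1.smooth_dy_sq]]) (use assms in auto)
  finally show ?thesis .
qed

text \<open>The blocks do interact here, because \<open>U2\<close> varies with the second base
  point. Contracted with \<open>y\<close>, this yields the term of the spray that is linear in
  \<open>p2 y\<close>.\<close>

lemma dx_dy_sq_H_mixed:
  assumes x: "p1 x \<in> X1" "p2 x \<in> X2" and y: "p1 y \<noteq> 0" "p2 y \<noteq> 0"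
  shows "dx (i2 k) (dy (i1 l) (sq H)) x y = dirderiv k U2 (p2 x) * dy l (sq H1) (p1 x) (p1 y)"
proof -
  have "dx (i2 k) (dy (i1 l) (sq H)) x y
      = dirderiv k (\<lambda>z. dy l (sq H1) (p1 x) (p1 y) * U2 z) (p2 x)"
    unfolding dx_eq two_blocks.dirderiv_block[OF warped_blocks.axioms(1)[OF swap]]
    by (rule dirderiv_cong[OF M2.open_X]) (use assms in \<open>auto simp: dy_sq_H\<close>)
  also have "\<dots> = dirderiv k U2 (p2 x) * dy l (sq H1) (p1 x) (p1 y)"
    using dirderiv_cmult[OF smooth_U(2)] x by simp
  finally show ?thesis .
qed

lemma dx_sq_H:
  assumes x: "p1 x \<in> X1" "p2 x \<in> X2" and y: "p1 y \<noteq> 0" "p2 y \<noteq> 0"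
  shows "dx (i1 l) (sq H) x y =
    U2 (p2 x) * dx l (sq H1) (p1 x) (p1 y) + dirderiv l U1 (p1 x) * sq H2 (p2 x) (p2 y)"
proof -
  have "dx (i1 l) (sq H) x y
      = dirderiv l (\<lambda>z. U2 (p2 x) * sq H1 z (p1 y) + sq H2 (p2 x) (p2 y) * U1 z) (p1 x)"
    unfolding dx_eq dirderiv_block
    by (rule dirderiv_cong[OF M1.open_X]) (use assms in \<open>auto simp: sq_H\<close>)
  also have "\<dots> = U2 (p2 x) * dx l (sq H1) (p1 x) (p1 y) + sq H2 (p2 x) (p2 y) * dirderiv l U1 (p1 x)"
    unfolding dx_eq
    by (rule dirderiv_cmult_add[OF M1.slice_fst[OF M1.smooth_sq] smooth_U(1)]) (use assms in auto)
  finally show ?thesis by simp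
qed

text \<open>The inverse matrix is block diagonal, so only derivatives with \<open>l\<close>-index in
  the first block enter. The factor \<open>U2\<close> cancels in the part that makes up the spray of
  \<open>H1\<close>. In \<open>p2 y\<close> the three terms have degrees 0, 1 and 2.\<close>

lemma spray_H:
  assumes x: "p1 x \<in> X1" "p2 x \<in> X2" and y: "p1 y \<noteq> 0" "p2 y \<noteq> 0" and l: "l \<in> Basis"
  shows "spray H (i1 l) x y = spray H1 l (p1 x) (p1 y)
    + warp_deriv U2 (p2 x) (p2 y) / (4 * U2 (p2 x)) * raised_dy H1 l (p1 x) (p1 y)
    + (- sq H2 (p2 x) (p2 y) / (4 * U2 (p2 x))) * raised_grad H1 U1 l (p1 x) (p1 y)"
proof -
  let ?u = "U2 (p2 x)" and ?w = "warp_deriv U2 (p2 x) (p2 y)" and ?q = "sq H2 (p2 x) (p2 y)"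
  have u: "?u \<noteq> 0" using U_pos(2)[OF x(2)] by auto
  have "spray H (i1 l) x y = 1/4 * (\<Sum>m\<in>Basis. fund_inv H1 l m (p1 x) (p1 y) / ?u *
      (?u * ((\<Sum>k\<in>Basis. dx k (dy m (sq H1)) (p1 x) (p1 y) * (p1 y \<bullet> k)) - dx m (sq H1) (p1 x) (p1 y))
       + ?w * dy m (sq H1) (p1 x) (p1 y) - ?q * dirderiv m U1 (p1 x)))"
    unfolding spray_def sum_Basis
    by (simp add: fund_inv_H[OF x y l] dx_dy_sq_H[OF x y] dx_dy_sq_H_mixed[OF x y] dx_sq_H[OF x y]
        warp_deriv_def sum_distrib_left sum_distrib_right algebra_simps cong: sum.cong)
  also have "\<dots> = (\<Sum>m\<in>Basis. 1/4 * (fund_inv H1 l m (p1 x) (p1 y) *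
      ((\<Sum>k\<in>Basis. dx k (dy m (sq H1)) (p1 x) (p1 y) * (p1 y \<bullet> k)) - dx m (sq H1) (p1 x) (p1 y)))
       + ?w / (4 * ?u) * (fund_inv H1 l m (p1 x) (p1 y) * dy m (sq H1) (p1 x) (p1 y))
       + (- ?q / (4 * ?u)) * (fund_inv H1 l m (p1 x) (p1 y) * dirderiv m U1 (p1 x)))"
    unfolding sum_distrib_left[of "1/4"] by (intro sum.cong refl) (use u in \<open>simp add: field_simps\<close>)
  also have "\<dots> = spray H1 l (p1 x) (p1 y) + ?w / (4 * ?u) * raised_dy H1 l (p1 x) (p1 y)
      + (- ?q / (4 * ?u)) * raised_grad H1 U1 l (p1 x) (p1 y)"
    unfolding sum.distrib sum_distrib_left[symmetric] spray_def raised_dy_def raised_grad_def ..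
  finally show ?thesis .
qed

end

text \<open>After squaring, compare coefficients of quartics: \<open>C = 0\<close> and
  \<open>A * B = 0\<close>, while \<open>A\<^sup>2 = K\<^sup>2 * p\<close> and
  \<open>B\<^sup>2 = K\<^sup>2 * q\<close>. One of \<open>A\<close>, \<open>B\<close> vanishes, and
  either case forces \<open>K = 0\<close>.\<close>

lemma quadratic_eq_sqrt_imp_zero:
  fixes A B C K p q :: real
  assumes eq: "\<And>t. t > 0 \<Longrightarrow> A + B * t + C * t\<^sup>2 = K * sqrt (p + q * t\<^sup>2)"
    and pq: "0 < p" "0 < q"
  shows "K = 0"
proof -
  have "(A + B * t + C * t\<^sup>2)\<^sup>2 = K\<^sup>2 * (p + q * t\<^sup>2)" if "t > 0" for t
    using eq[OF that] pq by (simp add: power_mult_distrib)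
  moreover have "(A + B * t + C * t\<^sup>2)\<^sup>2 = A\<^sup>2 + 2 * (A * B) * t + (B\<^sup>2 + 2 * (A * C)) * t\<^sup>2
      + 2 * (B * C) * t ^ 3 + C\<^sup>2 * t ^ 4" for t
    by algebra
  ultimately have sq: "A\<^sup>2 + 2 * (A * B) * t + (B\<^sup>2 + 2 * (A * C)) * t\<^sup>2 + 2 * (B * C) * t ^ 3 + C\<^sup>2 * t ^ 4
      = K\<^sup>2 * p + K\<^sup>2 * q * t\<^sup>2" if "t > 0" for t
    using that by (simp add: distrib_left mult.assoc)
  \<comment> \<open>A quartic has five coefficients, so five positive points turn the comparison
    into linear algebra.\<close>
  note eqs = sq[of 1, simplified] sq[of 2, simplified] sq[of 3, simplified] sq[of 4, simplified]
    sq[of 5, simplified]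
  have "C\<^sup>2 = 0" "A * B = 0" "B\<^sup>2 + 2 * (A * C) = K\<^sup>2 * q" "A\<^sup>2 = K\<^sup>2 * p"
    using eqs by linarith+
  then have "B\<^sup>2 = K\<^sup>2 * q" "A\<^sup>2 = K\<^sup>2 * p" "A = 0 \<or> B = 0" by auto
  then show ?thesis using pq by auto
qed

section \<open>Berwald, Landsberg and Cartan components, and the theorem in coordinates\<close>

context warped_blocks
begin

lemma spray_H_second:
  assumes x: "p1 x \<in> X1" "p2 x \<in> X2" and y: "p1 y \<noteq> 0" "p2 y \<noteq> 0" and l: "l \<in> Basis"
  shows "spray H (i2 l) x y = spray H2 l (p2 x) (p2 y)
    + warp_deriv U1 (p1 x) (p1 y) / (4 * U1 (p1 x)) * raised_dy H2 l (p2 x) (p2 y)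
    + (- sq H1 (p1 x) (p1 y) / (4 * U1 (p1 x))) * raised_grad H2 U2 l (p2 x) (p2 y)"
  using warped_blocks.spray_H[OF swap x(2,1) y(2,1) l] .

lemma y_lower_H_second:
  assumes x: "p1 x \<in> X1" "p2 x \<in> X2" and y: "p1 y \<noteq> 0" "p2 y \<noteq> 0"
  shows "y_lower H (i2 l) x y = U1 (p1 x) * y_lower H2 l (p2 x) (p2 y)"
  using warped_blocks.y_lower_H[OF swap x(2,1) y(2,1)] .

lemma berwald_H:
  assumes x: "p1 x \<in> X1" "p2 x \<in> X2" and y: "y \<noteq> 0" "y' \<noteq> 0" and l: "l \<in> Basis"
  shows "berwald H (i1 l) (i1 i) (i1 j) (i1 k) x (i1 y + i2 y') =
    dirderiv i (dirderiv j (dirderiv k (spray H1 l (p1 x)))) y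
    + warp_deriv U2 (p2 x) y' / (4 * U2 (p2 x)) * dirderiv i (dirderiv j (dirderiv k (raised_dy H1 l (p1 x)))) y
    + (- sq H2 (p2 x) y' / (4 * U2 (p2 x))) * dirderiv i (dirderiv j (dirderiv k (raised_grad H1 U1 l (p1 x)))) y"
proof -
  note s = M1.open_slit M1.smooth_spray[OF x(1) l] M1.smooth_raised(1,2)[OF x(1) l]
  have "berwald H (i1 l) (i1 i) (i1 j) (i1 k) x (i1 y + i2 y')
      = 1 * dirderiv i (dirderiv j (dirderiv k (spray H1 l (p1 x)))) y
    + warp_deriv U2 (p2 x) y' / (4 * U2 (p2 x)) * dirderiv i (dirderiv j (dirderiv k (raised_dy H1 l (p1 x)))) y
    + (- sq H2 (p2 x) y' / (4 * U2 (p2 x))) * dirderiv i (dirderiv j (dirderiv k (raised_grad H1 U1 l (p1 x)))) y"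
    unfolding berwald_def dy_dy_dy_block proj_add proj add_0_left add_0_right
    by (rule dirderiv3_cmult_add3[OF s])
      (use x y l in \<open>simp_all add: spray_H\<close>)
  then show ?thesis by simp
qed

text \<open>In the swapped spray formula the roles of the factors change: \<open>raised_dy\<close>
  and \<open>raised_grad\<close> of \<open>H2\<close> are now the fixed coefficients, and
  \<open>warp_deriv U1\<close> and \<open>sq H1\<close> are differentiated.\<close>

lemma berwald_H_second:
  assumes x: "p1 x \<in> X1" "p2 x \<in> X2" and y: "y \<noteq> 0" "y' \<noteq> 0" and l: "l \<in> Basis"
  shows "berwald H (i2 l) (i1 i) (i1 j) (i1 k) x (i1 y + i2 y') =
    raised_dy H2 l (p2 x) y' / (4 * U1 (p1 x)) * dirderiv i (dirderiv j (dirderiv k (warp_deriv U1 (p1 x)))) y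
    + (- raised_grad H2 U2 l (p2 x) y' / (4 * U1 (p1 x))) * dirderiv i (dirderiv j (dirderiv k (sq H1 (p1 x)))) y"
proof -
  \<comment> \<open>\<open>M1.smooth_raised\<close> has a premise on a basis index of the first
    block, whereas \<open>l\<close> belongs to the second.\<close>
  obtain b :: 'a where b: "b \<in> Basis" using nonempty_Basis by blast
  note s = M1.open_slit smooth_on_const M1.smooth_raised(3)[OF x(1) b] M1.slice[OF M1.smooth_sq x(1)]
  have "berwald H (i2 l) (i1 i) (i1 j) (i1 k) x (i1 y + i2 y')
      = spray H2 l (p2 x) y' * dirderiv i (dirderiv j (dirderiv k (\<lambda>_. 1))) y
    + raised_dy H2 l (p2 x) y' / (4 * U1 (p1 x)) * dirderiv i (dirderiv j (dirderiv k (warp_deriv U1 (p1 x)))) y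
    + (- raised_grad H2 U2 l (p2 x) y' / (4 * U1 (p1 x))) * dirderiv i (dirderiv j (dirderiv k (sq H1 (p1 x)))) y"
    unfolding berwald_def dy_dy_dy_block proj_add proj add_0_left add_0_right
    by (rule dirderiv3_cmult_add3[OF s])
      (use x y l in \<open>simp_all add: spray_H_second mult.commute\<close>)
  then show ?thesis by (simp add: dirderiv_const)
qed

lemma landsberg_H_quadratic:
  assumes x: "p1 x \<in> X1" "p2 x \<in> X2" and y: "y \<noteq> 0" "y' \<noteq> 0"
  shows "\<exists>A B C. \<forall>t>0. landsberg H (i1 i) (i1 j) (i1 k) x (i1 y + i2 (t *\<^sub>R y')) = A + B * t + C * t\<^sup>2"
proof -
  let ?D = "\<lambda>f. dirderiv i (dirderiv j (dirderiv k f)) y"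
  \<comment> \<open>Contributions sorted by degree in \<open>t\<close>: \<open>a\<close>,
    \<open>b\<close>, \<open>c\<close> from the first block have degrees 0, 1, 2; \<open>d\<close>
    and \<open>e\<close> from the second have degrees 1 and 2, one of which is due to
    \<open>y_lower H2\<close>.\<close>
  define a where "a l = U2 (p2 x) * y_lower H1 l (p1 x) y * ?D (spray H1 l (p1 x))" for l
  define b where "b l = U2 (p2 x) * y_lower H1 l (p1 x) y *
    (warp_deriv U2 (p2 x) y' / (4 * U2 (p2 x)) * ?D (raised_dy H1 l (p1 x)))" for l
  define c where "c l = U2 (p2 x) * y_lower H1 l (p1 x) y *
    ((- sq H2 (p2 x) y' / (4 * U2 (p2 x))) * ?D (raised_grad H1 U1 l (p1 x)))" for l
  define d where "d l = U1 (p1 x) * y_lower H2 l (p2 x) y' *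
    ((- raised_grad H2 U2 l (p2 x) y' / (4 * U1 (p1 x))) * ?D (sq H1 (p1 x)))" for l
  define e where "e l = U1 (p1 x) * y_lower H2 l (p2 x) y' *
    (raised_dy H2 l (p2 x) y' / (4 * U1 (p1 x)) * ?D (warp_deriv U1 (p1 x)))" for l
  have "landsberg H (i1 i) (i1 j) (i1 k) x (i1 y + i2 (t *\<^sub>R y')) =
      - 1/2 * sum a Basis + - 1/2 * (sum b Basis + sum d Basis) * t
      + - 1/2 * (sum c Basis + sum e Basis) * t\<^sup>2" if t: "t > 0" for t
  proof -
    have ty: "t *\<^sub>R y' \<noteq> 0" using y t by simp
    have 1: "y_lower H (i1 l) x (i1 y + i2 (t *\<^sub>R y')) * berwald H (i1 l) (i1 i) (i1 j) (i1 k) x (i1 y + i2 (t *\<^sub>R y'))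
        = a l + b l * t + c l * t\<^sup>2" if "l \<in> Basis" for l
      using x y ty that
      by (simp add: berwald_H y_lower_H a_def b_def c_def warp_deriv_scaleR M2.sq_homogeneous t algebra_simps)
    have 2: "y_lower H (i2 l) x (i1 y + i2 (t *\<^sub>R y')) * berwald H (i2 l) (i1 i) (i1 j) (i1 k) x (i1 y + i2 (t *\<^sub>R y'))
        = d l * t + e l * t\<^sup>2" if "l \<in> Basis" for l
      using x y ty that
      by (simp add: berwald_H_second y_lower_H_second d_def e_def M2.y_lower_homogeneous
          M2.raised_homogeneous t power2_eq_square algebra_simps)
    show ?thesis
      unfolding landsberg_def sum_Basis
      by (simp add: 1 2 sum.distrib sum_distrib_right[symmetric] sum_distrib_left[symmetric] algebra_simps)
  qed
  then show ?thesis by blast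
qed

lemma cartan_H:
  assumes x: "p1 x \<in> X1" "p2 x \<in> X2" and y: "p1 y \<noteq> 0" "p2 y \<noteq> 0"
  shows "cartan H (i1 i) (i1 j) (i1 k) x y = U2 (p2 x) * cartan H1 i j k (p1 x) (p1 y)"
proof -
  have "dy (i1 k) (fund H (i1 i) (i1 j)) x y
      = dirderiv k (\<lambda>z. U2 (p2 x) * fund H1 i j (p1 x) z) (p1 y)"
    unfolding dy_eq dirderiv_block
    by (rule dirderiv_cong[OF M1.open_slit]) (use assms in \<open>auto simp: fund_H\<close>)
  also have "\<dots> = U2 (p2 x) * dy k (fund H1 i j) (p1 x) (p1 y)"
    unfolding dy_eq
    by (rule dirderiv_cmult[OF M1.smooth_fund[OF x(1)]]) (use assms in auto)
  finally show ?thesis by (simp add: cartan_def)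
qed

lemma dy_fund_H_zero:
  assumes x: "p1 x \<in> X1" "p2 x \<in> X2" and y: "p1 y \<noteq> 0" "p2 y \<noteq> 0"
  shows "dy (i1 k) (fund H (i2 i) (i2 j)) x y = 0" "dy (i1 k) (fund H (i1 i') (i2 j)) x y = 0"
    "dy (i1 k) (fund H (i2 j) (i1 i')) x y = 0"
proof -
  have const: "dy (i1 k) (fund H I J) x y = 0"
    if "\<And>z. z \<noteq> 0 \<Longrightarrow> fund H I J x (i1 z + i2 (p2 y)) = c" for I J c
  proof -
    have "dy (i1 k) (fund H I J) x y = dirderiv k (\<lambda>z. c) (p1 y)"
      unfolding dy_eq dirderiv_block by (rule dirderiv_cong[OF M1.open_slit]) (use that y in auto)
    then show ?thesis by (simp add: dirderiv_const)
  qed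
  show "dy (i1 k) (fund H (i2 i) (i2 j)) x y = 0" "dy (i1 k) (fund H (i1 i') (i2 j)) x y = 0"
    "dy (i1 k) (fund H (i2 j) (i1 i')) x y = 0"
    by (rule const; simp add: fund_H_all x y)+
qed

text \<open>If the last index lies in the first block, the other two are not both in it, so the
  differentiated component of \<open>fund\<close> is constant in \<open>p1 y\<close>. The other case
  follows by swapping.\<close>

lemma cartan_H_mixed:
  assumes x: "p1 x \<in> X1" "p2 x \<in> X2" and y: "p1 y \<noteq> 0" "p2 y \<noteq> 0"
    and IJK: "I \<in> Basis" "J \<in> Basis" "K \<in> Basis"
    and mixed: "\<not> {I, J, K} \<subseteq> range i1" "\<not> {I, J, K} \<subseteq> range i2"
  shows "cartan H I J K x y = 0"
  using IJK mixed dy_fund_H_zero[OF x y] warped_blocks.dy_fund_H_zero[OF swap x(2,1) y(2,1)]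
  unfolding Basis_eq cartan_def by auto

text \<open>Isotropy is assumed on the whole fibre over \<open>x\<close> with one number
  \<open>c\<close>, since the equation is used along the curve obtained by rescaling
  \<open>p2 y\<close>.\<close>

lemma isotropic_cartan_zero:
  assumes x: "p1 x \<in> X1" "p2 x \<in> X2" and y: "p1 y \<noteq> 0" "p2 y \<noteq> 0"
    and iso: "\<And>z. p1 z \<noteq> 0 \<Longrightarrow> p2 z \<noteq> 0 \<Longrightarrow> landsberg H (i1 i) (i1 j) (i1 k) x z
      = c * H x z * cartan H (i1 i) (i1 j) (i1 k) x z"
  shows "c * cartan H (i1 i) (i1 j) (i1 k) x y = 0"
proof -
  \<comment> \<open>By \<open>cartan_H\<close> this is \<open>c\<close> times the Cartan component,
    visibly free of \<open>p2 y\<close>, hence the same for all \<open>t\<close>.\<close>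
  let ?K = "c * (U2 (p2 x) * cartan H1 i j k (p1 x) (p1 y))"
  let ?p = "U2 (p2 x) * sq H1 (p1 x) (p1 y)" and ?q = "U1 (p1 x) * sq H2 (p2 x) (p2 y)"
  obtain A B C where ABC: "\<And>t. t > 0 \<Longrightarrow>
      landsberg H (i1 i) (i1 j) (i1 k) x (i1 (p1 y) + i2 (t *\<^sub>R p2 y)) = A + B * t + C * t\<^sup>2"
    using landsberg_H_quadratic[OF x y] by metis
  have "A + B * t + C * t\<^sup>2 = ?K * sqrt (?p + ?q * t\<^sup>2)" if t: "t > 0" for t
  proof -
    let ?z = "i1 (p1 y) + i2 (t *\<^sub>R p2 y)"
    have z: "p1 ?z = p1 y" "p2 ?z = t *\<^sub>R p2 y" by simp_all
    have nz: "p1 ?z \<noteq> 0" "p2 ?z \<noteq> 0" using y t by simp_all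
    have "H x ?z = sqrt (sq H x ?z)" using H_nonneg[OF x] by (simp add: sq_def)
    also have "sq H x ?z = ?p + ?q * t\<^sup>2"
      using t x y by (simp add: sq_H M2.sq_homogeneous)
    finally have "H x ?z = sqrt (?p + ?q * t\<^sup>2)" .
    then show ?thesis
      using iso[OF nz] ABC[OF t] cartan_H[OF x nz, of i j k] by (simp add: z del: proj_add)
  qed
  then have "?K = 0"
    by (rule quadratic_eq_sqrt_imp_zero) (use x y U_pos M1.sq_pos M2.sq_pos in auto)
  then show ?thesis by (simp add: cartan_H[OF x y])
qed

lemma isotropic_landsberg_zero:
  assumes x: "p1 x \<in> X1" "p2 x \<in> X2" and y: "p1 y \<noteq> 0" "p2 y \<noteq> 0"
    and IJK: "I \<in> Basis" "J \<in> Basis" "K \<in> Basis"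
    and iso: "\<And>z I J K. p1 z \<noteq> 0 \<Longrightarrow> p2 z \<noteq> 0 \<Longrightarrow> I \<in> Basis \<Longrightarrow> J \<in> Basis \<Longrightarrow> K \<in> Basis \<Longrightarrow>
      landsberg H I J K x z = c * H x z * cartan H I J K x z"
  shows "landsberg H I J K x y = 0"
proof -
  have "c * cartan H I J K x y = 0"
  proof (cases "{I, J, K} \<subseteq> range i1 \<or> {I, J, K} \<subseteq> range i2")
    case False
    then show ?thesis using cartan_H_mixed[OF x y IJK] by simp
  next
    case True
    then consider i j k where "I = i1 i" "J = i1 j" "K = i1 k"
      | i j k where "I = i2 i" "J = i2 j" "K = i2 k" by auto
    then show ?thesis
    proof cases
      case 1
      then show ?thesis using isotropic_cartan_zero[OF x y iso] IJK by simp
    next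
      case 2
      then show ?thesis
        using warped_blocks.isotropic_cartan_zero[OF swap x(2,1) y(2,1) iso] IJK by simp
    qed
  qed
  then show ?thesis using iso[OF y IJK] by auto
qed

end

section \<open>Tangent vectors in charts\<close>

definition overlap :: "('m, 'a) chart \<Rightarrow> ('m, 'a) chart \<Rightarrow> 'a set" where
  "overlap c d = coord c ` (chart_dom c \<inter> chart_dom d)"

text \<open>The derivative occurring in \<open>tangent_bundle\<close> and \<open>tangent_of\<close>,
  indexed by the point rather than its coordinates, so that changing charts becomes a cocycle
  identity.\<close>

definition transition_deriv ::
  "('m, 'a::real_normed_vector) chart \<Rightarrow> ('m, 'a) chart \<Rightarrow> 'm \<Rightarrow> 'a \<Rightarrow> 'a" where
  "transition_deriv c d p = frechet_derivative (coord d \<circ> inv_coord c) (at (coord c p))"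

text \<open>The part of \<open>smooth_manifold\<close> that the calculus of tangent vectors needs.\<close>

definition differentiable_atlas :: "('m, 'a::real_normed_vector) chart set \<Rightarrow> bool" where
  "differentiable_atlas A \<longleftrightarrow> (\<Union>c\<in>A. chart_dom c) = UNIV \<and> (\<forall>c\<in>A. inj_on (coord c) (chart_dom c)) \<and>
     (\<forall>c\<in>A. \<forall>d\<in>A. open (overlap c d) \<and>
        (\<forall>x\<in>overlap c d. (coord d \<circ> inv_coord c) differentiable (at x)))"

lemma smooth_manifold_differentiable_atlas:
  assumes "smooth_manifold A"
  shows "differentiable_atlas A"
  unfolding differentiable_atlas_def
proof (intro conjI ballI)
  show "(\<Union>c\<in>A. chart_dom c) = UNIV" using assms by (simp add: smooth_manifold_def)
  have hom: "homeomorphism (chart_dom c) (chart_range c) (coord c) (inv_coord c)"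
    and o: "open (chart_range c)" "open (chart_dom c)" if "c \<in> A" for c
    using assms that by (auto simp: smooth_manifold_def is_chart_def)
  show "inj_on (coord c) (chart_dom c)" if "c \<in> A" for c
    by (rule inj_on_inverseI[of _ "inv_coord c"]) (rule homeomorphism_apply1[OF hom[OF that]])
  fix c d assume cd: "c \<in> A" "d \<in> A"
  have "openin (top_of_set (chart_range c)) (overlap c d)"
    unfolding overlap_def
    by (rule homeomorphism_imp_open_map[OF hom[OF cd(1)]]) (rule openin_open_Int[OF o(2)[OF cd(2)]])
  then show "open (overlap c d)" using o(1)[OF cd(1)] openin_open_trans by blast
  have "smooth_on (overlap c d) (coord d \<circ> inv_coord c)"
    using assms cd by (auto simp: smooth_manifold_def overlap_def)
  then show "(coord d \<circ> inv_coord c) differentiable (at x)" if "x \<in> overlap c d" for x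
    using that smooth_on_has_derivative differentiable_def by blast
qed

context
  fixes A :: "('m, 'a::euclidean_space) chart set"
  assumes A: "differentiable_atlas A"
begin

lemma atlas_cover: obtains c where "c \<in> A" "p \<in> chart_dom c"
  using A unfolding differentiable_atlas_def by blast

lemma open_overlap: "c \<in> A \<Longrightarrow> d \<in> A \<Longrightarrow> open (overlap c d)"
  using A by (simp add: differentiable_atlas_def)

lemma inv_coord_coord [simp]: "c \<in> A \<Longrightarrow> p \<in> chart_dom c \<Longrightarrow> inv_coord c (coord c p) = p"
  using A by (simp add: differentiable_atlas_def inv_coord_def)

lemma coord_in_overlap: "p \<in> chart_dom c \<Longrightarrow> p \<in> chart_dom d \<Longrightarrow> coord c p \<in> overlap c d"
  by (simp add: overlap_def)

lemma transition_has_derivative: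
  assumes "c \<in> A" "d \<in> A" "p \<in> chart_dom c" "p \<in> chart_dom d"
  shows "((coord d \<circ> inv_coord c) has_derivative transition_deriv c d p) (at (coord c p))"
  using A assms coord_in_overlap[OF assms(3,4)]
  by (simp add: differentiable_atlas_def frechet_derivative_works transition_deriv_def)

lemma linear_transition_deriv:
  assumes "c \<in> A" "d \<in> A" "p \<in> chart_dom c" "p \<in> chart_dom d"
  shows "linear (transition_deriv c d p)"
  using transition_has_derivative[OF assms] has_derivative_linear by blast

text \<open>The chain rule, as the two transition maps compose to the third near the point. It makes
  \<open>tangent_of\<close> compatible across charts, and later the differential independent of its
  chosen chart.\<close>

lemma transition_deriv_chain:
  assumes c: "c \<in> A" "p \<in> chart_dom c" and d: "d \<in> A" "p \<in> chart_dom d"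
    and e: "e \<in> A" "p \<in> chart_dom e"
  shows "transition_deriv c e p v = transition_deriv d e p (transition_deriv c d p v)"
proof -
  have "((coord e \<circ> inv_coord d) \<circ> (coord d \<circ> inv_coord c) has_derivative
      transition_deriv d e p \<circ> transition_deriv c d p) (at (coord c p))"
    by (rule diff_chain_at) (use c d e in \<open>simp_all add: transition_has_derivative\<close>)
  then have "((coord e \<circ> inv_coord c) has_derivative
      transition_deriv d e p \<circ> transition_deriv c d p) (at (coord c p))"
    by (rule has_derivative_transform_within_open[OF _ open_overlap[OF c(1) d(1)] coord_in_overlap])
      (use c d in \<open>auto simp: overlap_def\<close>)
  from frechet_derivative_at[OF this] show ?thesis
    by (simp add: transition_deriv_def fun_eq_iff)
qed

lemma transition_deriv_refl:
  assumes c: "c \<in> A" "p \<in> chart_dom c"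
  shows "transition_deriv c c p v = v"
proof -
  have "((coord c \<circ> inv_coord c) has_derivative (\<lambda>v. v)) (at (coord c p))"
    by (rule has_derivative_transform_within_open[OF has_derivative_ident open_overlap[OF c(1) c(1)] coord_in_overlap])
      (use c in \<open>auto simp: overlap_def\<close>)
  from frechet_derivative_at[OF this] show ?thesis
    by (simp add: transition_deriv_def fun_eq_iff)
qed

lemma tangent_of_eq:
  assumes "c \<in> A" "p \<in> chart_dom c"
  shows "tangent_of A c (coord c p) y =
    (p, \<lambda>d. if d \<in> A \<and> p \<in> chart_dom d then transition_deriv c d p y else 0)"
  using assms by (simp add: tangent_of_def transition_deriv_def fun_eq_iff)

lemma tangent_of_in_bundle:
  assumes "c \<in> A" "p \<in> chart_dom c"
  shows "tangent_of A c (coord c p) y \<in> tangent_bundle A"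
  using assms
  by (auto simp: tangent_of_eq tangent_bundle_def transition_deriv_def[symmetric]
      intro: transition_deriv_chain)

lemma tangent_of_components:
  assumes "(p, v) \<in> tangent_bundle A" "c \<in> A" "p \<in> chart_dom c"
  shows "tangent_of A c (coord c p) (v c) = (p, v)"
proof -
  have "transition_deriv c d p (v c) = v d" if "d \<in> A" "p \<in> chart_dom d" for d
    using assms that unfolding transition_deriv_def tangent_bundle_def mem_Collect_eq prod.case
    by (metis (no_types, lifting))
  moreover have "v d = 0" if "\<not> (d \<in> A \<and> p \<in> chart_dom d)" for d
    using assms(1) that by (simp add: tangent_bundle_def del: split_paired_All)
  ultimately show ?thesis using assms(2,3) by (simp only: tangent_of_eq) (metis (no_types, lifting))
qed

lemma tangent_of_scaleR:
  assumes "c \<in> A" "p \<in> chart_dom c"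
  shows "tangent_of A c (coord c p) (r *\<^sub>R y) = scale_tangent r (tangent_of A c (coord c p) y)"
  using assms linear_transition_deriv
  by (auto simp: tangent_of_eq scale_tangent_def fun_eq_iff linear_cmul)

lemma zero_vector_tangent_of:
  assumes "c \<in> A" "p \<in> chart_dom c"
  shows "zero_vector (tangent_of A c (coord c p) y) \<longleftrightarrow> y = 0"
proof
  assume "zero_vector (tangent_of A c (coord c p) y)"
  then have "snd (tangent_of A c (coord c p) y) c = 0" by (simp add: zero_vector_def)
  then show "y = 0" using assms by (simp add: tangent_of_eq transition_deriv_refl)
next
  assume "y = 0"
  then show "zero_vector (tangent_of A c (coord c p) y)"
    using assms linear_transition_deriv
    by (auto simp: tangent_of_eq zero_vector_def fun_eq_iff linear_0)
qed

end

lemma finsler_function_local_rep: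
  assumes F: "finsler_manifold A F" and c: "c \<in> A"
  shows "finsler_function (chart_range c) (local_rep A F c)"
proof
  have A: "differentiable_atlas A"
    using F smooth_manifold_differentiable_atlas by (auto simp: finsler_manifold_def)
  have M: "finsler_metric A F" using F by (simp add: finsler_manifold_def)
  show "open (chart_range c)"
    using F c by (auto simp: finsler_manifold_def smooth_manifold_def is_chart_def)
  show "smooth_on (chart_range c \<times> (UNIV - {0})) (\<lambda>(x, y). local_rep A F c x y)"
    using M c by (simp add: finsler_metric_def)
  fix x y assume "x \<in> chart_range c"
  then obtain p where p: "x = coord c p" "p \<in> chart_dom c" by (auto simp: chart_range_def)
  show "local_rep A F c x (r *\<^sub>R y) = r * local_rep A F c x y" if "r > 0" for r
    using M that tangent_of_in_bundle[OF A c p(2)]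
    by (simp add: local_rep_def p(1) tangent_of_scaleR[OF A c p(2)] finsler_metric_def)
  show "0 < (\<Sum>i\<in>Basis. \<Sum>j\<in>Basis. fund (local_rep A F c) i j x y * (v \<bullet> i) * (v \<bullet> j))"
    if "y \<noteq> 0" "v \<noteq> 0" for v
    using M c that \<open>x \<in> chart_range c\<close> by (simp add: finsler_metric_def)
qed

section \<open>Product charts\<close>

lemma product_chart_simps [simp]:
  "chart_dom (product_chart c d) = chart_dom c \<times> chart_dom d"
  "coord (product_chart c d) (p, q) = (coord c p, coord d q)"
  by (simp_all add: product_chart_def)

lemma product_atlas_iff: "\<kappa> \<in> product_atlas A B \<longleftrightarrow> (\<exists>c\<in>A. \<exists>d\<in>B. \<kappa> = product_chart c d)"
  by (auto simp: product_atlas_def)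

lemma product_chart_in_atlas: "c \<in> A \<Longrightarrow> d \<in> B \<Longrightarrow> product_chart c d \<in> product_atlas A B"
  unfolding product_atlas_def by blast

lemma overlap_product:
  "overlap (product_chart c d) (product_chart c' d') = overlap c c' \<times> overlap d d'"
  by (simp add: overlap_def product_chart_def Times_Int_Times map_prod_surj_on)

context
  fixes A :: "('m, 'a::euclidean_space) chart set" and B :: "('n, 'b::euclidean_space) chart set"
  assumes A: "differentiable_atlas A" and B: "differentiable_atlas B"
begin

lemma inv_coord_product:
  assumes "c \<in> A" "d \<in> B" "p \<in> chart_dom c" "q \<in> chart_dom d"
  shows "inv_coord (product_chart c d) (coord c p, coord d q) = (p, q)"
proof -
  have "inj_on (coord (product_chart c d)) (chart_dom (product_chart c d))"
    using A B assms by (auto simp: differentiable_atlas_def inj_on_def)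
  from inv_into_f_f[OF this, of "(p, q)"] assms show ?thesis by (simp add: inv_coord_def)
qed

lemma product_transition_has_derivative:
  assumes c: "c \<in> A" "c' \<in> A" "p \<in> chart_dom c" "p \<in> chart_dom c'"
    and d: "d \<in> B" "d' \<in> B" "q \<in> chart_dom d" "q \<in> chart_dom d'"
  shows "((coord (product_chart c' d') \<circ> inv_coord (product_chart c d)) has_derivative
    (\<lambda>v. (transition_deriv c c' p (fst v), transition_deriv d d' q (snd v)))) (at (coord c p, coord d q))"
proof -
  have "((\<lambda>x. ((coord c' \<circ> inv_coord c) (fst x), (coord d' \<circ> inv_coord d) (snd x))) has_derivative
    (\<lambda>v. (transition_deriv c c' p (fst v), transition_deriv d d' q (snd v)))) (at (coord c p, coord d q))"
    by (intro has_derivative_Pair has_derivative_compose[OF has_derivative_fst[OF has_derivative_ident]]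
        has_derivative_compose[OF has_derivative_snd[OF has_derivative_ident]])
      (simp_all add: assms transition_has_derivative[OF A, unfolded o_def]
          transition_has_derivative[OF B, unfolded o_def])
  then show ?thesis
  proof (rule has_derivative_transform_within_open)
    show "open (overlap c c' \<times> overlap d d')"
      using open_overlap[OF A c(1,2)] open_overlap[OF B d(1,2)] by (rule open_Times)
    show "(coord c p, coord d q) \<in> overlap c c' \<times> overlap d d'"
      using assms by (simp add: overlap_def)
    fix x assume "x \<in> overlap c c' \<times> overlap d d'"
    then obtain p' q' where "x = (coord c p', coord d q')" "p' \<in> chart_dom c" "q' \<in> chart_dom d"
      unfolding overlap_def by blast
    then show "((coord c' \<circ> inv_coord c) (fst x), (coord d' \<circ> inv_coord d) (snd x)) =
        (coord (product_chart c' d') \<circ> inv_coord (product_chart c d)) x"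
      using c d by (simp add: inv_coord_product inv_coord_coord[OF A] inv_coord_coord[OF B])
  qed
qed

lemma differentiable_product_atlas: "differentiable_atlas (product_atlas A B)"
  unfolding differentiable_atlas_def
proof (intro conjI ballI)
  show "(\<Union>\<kappa>\<in>product_atlas A B. chart_dom \<kappa>) = UNIV"
  proof (intro equalityI subset_UNIV subsetI)
    fix r :: "'m \<times> 'n"
    obtain p q where r: "r = (p, q)" by (cases r)
    obtain c d where "c \<in> A" "p \<in> chart_dom c" "d \<in> B" "q \<in> chart_dom d"
      using atlas_cover[OF A] atlas_cover[OF B] by metis
    then show "r \<in> (\<Union>\<kappa>\<in>product_atlas A B. chart_dom \<kappa>)"
      unfolding r by (intro UN_I[of "product_chart c d"]) (auto simp: product_atlas_iff)
  qed
  show "inj_on (coord \<kappa>) (chart_dom \<kappa>)" if "\<kappa> \<in> product_atlas A B" for \<kappa>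
    using A B that by (auto simp: differentiable_atlas_def inj_on_def product_atlas_iff)
  fix \<kappa> \<kappa>' assume "\<kappa> \<in> product_atlas A B" "\<kappa>' \<in> product_atlas A B"
  then obtain c d c' d' where \<kappa>: "\<kappa> = product_chart c d" "\<kappa>' = product_chart c' d'"
    and cd: "c \<in> A" "c' \<in> A" "d \<in> B" "d' \<in> B" by (auto simp: product_atlas_iff)
  show "open (overlap \<kappa> \<kappa>')"
    unfolding \<kappa> overlap_product by (intro open_Times open_overlap[OF A] open_overlap[OF B] cd)
  fix x assume "x \<in> overlap \<kappa> \<kappa>'"
  then obtain p q where "x = (coord c p, coord d q)" "p \<in> chart_dom c" "p \<in> chart_dom c'"
    "q \<in> chart_dom d" "q \<in> chart_dom d'" by (auto simp: \<kappa> overlap_def)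
  with product_transition_has_derivative[OF cd(1,2) _ _ cd(3,4)]
  show "(coord \<kappa>' \<circ> inv_coord \<kappa>) differentiable at x"
    unfolding \<kappa> differentiable_def by blast
qed

lemma transition_deriv_product:
  assumes "c \<in> A" "c' \<in> A" "p \<in> chart_dom c" "p \<in> chart_dom c'"
    and "d \<in> B" "d' \<in> B" "q \<in> chart_dom d" "q \<in> chart_dom d'"
  shows "transition_deriv (product_chart c d) (product_chart c' d') (p, q) v =
    (transition_deriv c c' p (fst v), transition_deriv d d' q (snd v))"
  using frechet_derivative_at[OF product_transition_has_derivative[OF assms]]
  unfolding transition_deriv_def[of "product_chart c d"] by (simp add: fun_eq_iff)

text \<open>Whatever product chart \<open>differential\<close> selects, its first factor
  \<open>c'\<close> enters only via the passage from \<open>c\<close> through \<open>c'\<close> to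
  the target chart, which the cocycle identity collapses. The second factor is analogous.\<close>

lemma differential_projections:
  assumes c: "c \<in> A" "p \<in> chart_dom c" and d: "d \<in> B" "q \<in> chart_dom d"
  shows "tangent_fst A B (tangent_of (product_atlas A B) (product_chart c d) (coord c p, coord d q) (y, z))
      = tangent_of A c (coord c p) y" (is "?fst")
    and "tangent_snd A B (tangent_of (product_atlas A B) (product_chart c d) (coord c p, coord d q) (y, z))
      = tangent_of B d (coord d q) z" (is "?snd")
proof -
  let ?P = "product_atlas A B"
  \<comment> \<open>The chart picked inside \<open>differential\<close>; it may differ from
    \<open>product_chart c d\<close>.\<close>
  define \<kappa> where "\<kappa> = (SOME \<kappa>. \<kappa> \<in> ?P \<and> (p, q) \<in> chart_dom \<kappa>)"
  have "\<kappa> \<in> ?P \<and> (p, q) \<in> chart_dom \<kappa>"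
    unfolding \<kappa>_def
    by (rule someI[of _ "product_chart c d"]) (use c d in \<open>simp add: product_chart_in_atlas\<close>)
  then obtain c' d' where \<kappa>: "\<kappa> = product_chart c' d'" and c': "c' \<in> A" "p \<in> chart_dom c'"
    and d': "d' \<in> B" "q \<in> chart_dom d'" by (auto simp: product_atlas_iff simp del: split_paired_Ex split_paired_All)
  define w where "w = tangent_of ?P (product_chart c d) (coord c p, coord d q) (y, z)"
  have w: "fst w = (p, q)" "snd w \<kappa> = (transition_deriv c c' p y, transition_deriv d d' q z)"
    using c d c' d'
    by (simp_all add: w_def \<kappa> product_chart_in_atlas transition_deriv_product
        tangent_of_eq[OF differentiable_product_atlas, of "product_chart c d" "(p, q)", simplified])
  have op: "open (overlap c' c' \<times> overlap d' d')"
    by (intro open_Times open_overlap[OF A] open_overlap[OF B] c' d')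
  have mem: "(coord c' p, coord d' q) \<in> overlap c' c' \<times> overlap d' d'"
    using c' d' by (simp add: overlap_def)
  have D1: "frechet_derivative (coord e \<circ> fst \<circ> inv_coord \<kappa>) (at (coord \<kappa> (p, q))) v
      = transition_deriv c' e p (fst v)" if e: "e \<in> A" "p \<in> chart_dom e" for e v
  proof -
    have "((\<lambda>x. (coord e \<circ> inv_coord c') (fst x)) has_derivative (\<lambda>v. transition_deriv c' e p (fst v)))
        (at (coord c' p, coord d' q))"
      by (intro has_derivative_compose[OF has_derivative_fst[OF has_derivative_ident]])
        (use transition_has_derivative[OF A c'(1) e(1) c'(2) e(2)] in \<open>simp add: o_def\<close>)
    then have "((coord e \<circ> fst \<circ> inv_coord \<kappa>) has_derivative (\<lambda>v. transition_deriv c' e p (fst v)))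
        (at (coord c' p, coord d' q))"
    proof (rule has_derivative_transform_within_open[OF _ op mem])
      fix x assume "x \<in> overlap c' c' \<times> overlap d' d'"
      then obtain p' q' where "x = (coord c' p', coord d' q')" "p' \<in> chart_dom c'" "q' \<in> chart_dom d'"
        unfolding overlap_def by blast
      then show "(coord e \<circ> inv_coord c') (fst x) = (coord e \<circ> fst \<circ> inv_coord \<kappa>) x"
        using c' d' by (simp add: \<kappa> inv_coord_product inv_coord_coord[OF A])
    qed
    from fun_cong[OF frechet_derivative_at[OF this], of v] show ?thesis by (simp add: \<kappa>)
  qed
  have D2: "frechet_derivative (coord e \<circ> snd \<circ> inv_coord \<kappa>) (at (coord \<kappa> (p, q))) v
      = transition_deriv d' e q (snd v)" if e: "e \<in> B" "q \<in> chart_dom e" for e v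
  proof -
    have "((\<lambda>x. (coord e \<circ> inv_coord d') (snd x)) has_derivative (\<lambda>v. transition_deriv d' e q (snd v)))
        (at (coord c' p, coord d' q))"
      by (intro has_derivative_compose[OF has_derivative_snd[OF has_derivative_ident]])
        (use transition_has_derivative[OF B d'(1) e(1) d'(2) e(2)] in \<open>simp add: o_def\<close>)
    then have "((coord e \<circ> snd \<circ> inv_coord \<kappa>) has_derivative (\<lambda>v. transition_deriv d' e q (snd v)))
        (at (coord c' p, coord d' q))"
    proof (rule has_derivative_transform_within_open[OF _ op mem])
      fix x assume "x \<in> overlap c' c' \<times> overlap d' d'"
      then obtain p' q' where "x = (coord c' p', coord d' q')" "p' \<in> chart_dom c'" "q' \<in> chart_dom d'"
        unfolding overlap_def by blast
      then show "(coord e \<circ> inv_coord d') (snd x) = (coord e \<circ> snd \<circ> inv_coord \<kappa>) x"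
        using c' d' by (simp add: \<kappa> inv_coord_product inv_coord_coord[OF B])
    qed
    from fun_cong[OF frechet_derivative_at[OF this], of v] show ?thesis by (simp add: \<kappa>)
  qed
  show ?fst
    unfolding w_def[symmetric] tangent_fst_def differential_def w(1) \<kappa>_def[symmetric] Let_def
    by (simp add: tangent_of_eq[OF A c] D1 w(2) transition_deriv_chain[OF A c c', symmetric] fun_eq_iff
        del: split_paired_All)
  show ?snd
    unfolding w_def[symmetric] tangent_snd_def differential_def w(1) \<kappa>_def[symmetric] Let_def
    by (simp add: tangent_of_eq[OF B d] D2 w(2) transition_deriv_chain[OF B d d', symmetric] fun_eq_iff
        del: split_paired_All)
qed

lemma local_rep_doubly_warped:
  assumes "c \<in> A" "p \<in> chart_dom c" "d \<in> B" "q \<in> chart_dom d"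
  shows "local_rep (product_atlas A B) (doubly_warped A B F\<^sub>1 F\<^sub>2 f\<^sub>1 f\<^sub>2) (product_chart c d)
      (coord c p, coord d q) (y, z) =
    sqrt ((f\<^sub>2 q)\<^sup>2 * (local_rep A F\<^sub>1 c (coord c p) y)\<^sup>2 + (f\<^sub>1 p)\<^sup>2 * (local_rep B F\<^sub>2 d (coord d q) z)\<^sup>2)"
  using assms
  by (simp add: local_rep_def doubly_warped_def differential_projections tangent_of_eq[OF A] tangent_of_eq[OF B] Let_def)

lemma tangent_of_in_doubly_slit_bundle:
  assumes "c \<in> A" "p \<in> chart_dom c" "d \<in> B" "q \<in> chart_dom d"
  shows "tangent_of (product_atlas A B) (product_chart c d) (coord c p, coord d q) (y, z)
      \<in> doubly_slit_bundle A B \<longleftrightarrow> y \<noteq> 0 \<and> z \<noteq> 0"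
  using assms tangent_of_in_bundle[OF differentiable_product_atlas, of "product_chart c d" "(p, q)"]
  by (simp add: doubly_slit_bundle_def differential_projections product_chart_in_atlas
      zero_vector_tangent_of[OF A] zero_vector_tangent_of[OF B])

end

section \<open>From coordinates to the doubly warped product of manifolds\<close>

lemma two_blocks_prod: "two_blocks (\<lambda>a. (a, 0)) (\<lambda>b. (0, b)) fst snd"
proof (rule two_blocks.intro)
  show "linear (\<lambda>a::'a. (a, 0::'b))" "linear (\<lambda>b::'b. (0::'a, b))" by (auto intro: linearI)
qed (auto simp: Basis_prod_def linear_fst linear_snd inner_prod_def)

lemma warped_blocks_doubly_warped:
  assumes F: "finsler_manifold A\<^sub>1 F\<^sub>1" "finsler_manifold A\<^sub>2 F\<^sub>2"
    and f\<^sub>1: "smooth_fun A\<^sub>1 f\<^sub>1" "\<And>p. 0 < f\<^sub>1 p" and f\<^sub>2: "smooth_fun A\<^sub>2 f\<^sub>2" "\<And>q. 0 < f\<^sub>2 q"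
    and c: "c \<in> A\<^sub>1" and d: "d \<in> A\<^sub>2"
  shows "warped_blocks (\<lambda>a. (a, 0)) (\<lambda>b. (0, b)) fst snd (chart_range c) (chart_range d)
    (local_rep A\<^sub>1 F\<^sub>1 c) (local_rep A\<^sub>2 F\<^sub>2 d)
    (local_rep (product_atlas A\<^sub>1 A\<^sub>2) (doubly_warped A\<^sub>1 A\<^sub>2 F\<^sub>1 F\<^sub>2 f\<^sub>1 f\<^sub>2) (product_chart c d))
    (\<lambda>x. (f\<^sub>1 (inv_coord c x))\<^sup>2) (\<lambda>x. (f\<^sub>2 (inv_coord d x))\<^sup>2)"
proof -
  have A: "differentiable_atlas A\<^sub>1" "differentiable_atlas A\<^sub>2"
    using F smooth_manifold_differentiable_atlas by (auto simp: finsler_manifold_def)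
  interpret M1: finsler_function "chart_range c" "local_rep A\<^sub>1 F\<^sub>1 c"
    by (rule finsler_function_local_rep[OF F(1) c])
  interpret M2: finsler_function "chart_range d" "local_rep A\<^sub>2 F\<^sub>2 d"
    by (rule finsler_function_local_rep[OF F(2) d])
  let ?H = "local_rep (product_atlas A\<^sub>1 A\<^sub>2) (doubly_warped A\<^sub>1 A\<^sub>2 F\<^sub>1 F\<^sub>2 f\<^sub>1 f\<^sub>2) (product_chart c d)"
  have H: "?H x y = sqrt ((f\<^sub>2 (inv_coord d (snd x)))\<^sup>2 * (local_rep A\<^sub>1 F\<^sub>1 c (fst x) (fst y))\<^sup>2
      + (f\<^sub>1 (inv_coord c (fst x)))\<^sup>2 * (local_rep A\<^sub>2 F\<^sub>2 d (snd x) (snd y))\<^sup>2)"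
    if x: "fst x \<in> chart_range c" "snd x \<in> chart_range d" for x y
  proof -
    obtain p q where "x = (coord c p, coord d q)" "p \<in> chart_dom c" "q \<in> chart_dom d"
      using x by (cases x) (auto simp: chart_range_def)
    then show ?thesis
      using local_rep_doubly_warped[OF A c _ d, of p q F\<^sub>1 F\<^sub>2 f\<^sub>1 f\<^sub>2 "fst y" "snd y"] A c d
      by simp
  qed
  show ?thesis
  proof (intro warped_blocks.intro warped_blocks_axioms.intro two_blocks_prod
      M1.finsler_function_axioms M2.finsler_function_axioms)
    show "smooth_on (chart_range c) (\<lambda>x. (f\<^sub>1 (inv_coord c x))\<^sup>2)"
      using smooth_on_mult[OF M1.open_X, of "f\<^sub>1 \<circ> inv_coord c" "f\<^sub>1 \<circ> inv_coord c"] f\<^sub>1 c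
      by (simp add: smooth_fun_def power2_eq_square)
    show "smooth_on (chart_range d) (\<lambda>x. (f\<^sub>2 (inv_coord d x))\<^sup>2)"
      using smooth_on_mult[OF M2.open_X, of "f\<^sub>2 \<circ> inv_coord d" "f\<^sub>2 \<circ> inv_coord d"] f\<^sub>2 d
      by (simp add: smooth_fun_def power2_eq_square)
    show "0 < (f\<^sub>1 (inv_coord c x))\<^sup>2" "0 < (f\<^sub>2 (inv_coord d x'))\<^sup>2" for x x'
      using f\<^sub>1(2)[of "inv_coord c x"] f\<^sub>2(2)[of "inv_coord d x'"] by simp_all
  qed (simp_all add: H sq_def)
qed

theorem theorem7:
  fixes A\<^sub>1 :: "('m::{t2_space, second_countable_topology}, 'a::euclidean_space) chart set"
    and A\<^sub>2 :: "('n::{t2_space, second_countable_topology}, 'b::euclidean_space) chart set"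
    and F\<^sub>1 :: "('m, 'a) tangent \<Rightarrow> real"
    and F\<^sub>2 :: "('n, 'b) tangent \<Rightarrow> real"
    and f\<^sub>1 :: "'m \<Rightarrow> real"
    and f\<^sub>2 :: "'n \<Rightarrow> real"
    and c :: "'m \<times> 'n \<Rightarrow> real"
  assumes "finsler_manifold A\<^sub>1 F\<^sub>1" and "finsler_manifold A\<^sub>2 F\<^sub>2"
    and "smooth_fun A\<^sub>1 f\<^sub>1" and "\<And>p. 0 < f\<^sub>1 p"
    and "smooth_fun A\<^sub>2 f\<^sub>2" and "\<And>q. 0 < f\<^sub>2 q"
    and "relatively_isotropic_landsberg_on (product_atlas A\<^sub>1 A\<^sub>2) (doubly_slit_bundle A\<^sub>1 A\<^sub>2)
           (doubly_warped A\<^sub>1 A\<^sub>2 F\<^sub>1 F\<^sub>2 f\<^sub>1 f\<^sub>2) c"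
  shows "landsberg_metric_on (product_atlas A\<^sub>1 A\<^sub>2) (doubly_slit_bundle A\<^sub>1 A\<^sub>2)
           (doubly_warped A\<^sub>1 A\<^sub>2 F\<^sub>1 F\<^sub>2 f\<^sub>1 f\<^sub>2)"
  unfolding landsberg_metric_on_def
proof (intro ballI impI)
  let ?P = "product_atlas A\<^sub>1 A\<^sub>2" and ?F = "doubly_warped A\<^sub>1 A\<^sub>2 F\<^sub>1 F\<^sub>2 f\<^sub>1 f\<^sub>2"
  fix w \<kappa> and I J K :: "'a \<times> 'b"
  assume w: "w \<in> doubly_slit_bundle A\<^sub>1 A\<^sub>2" and \<kappa>: "\<kappa> \<in> ?P" "fst w \<in> chart_dom \<kappa>"
    and IJK: "I \<in> Basis" "J \<in> Basis" "K \<in> Basis"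
  have A: "differentiable_atlas A\<^sub>1" "differentiable_atlas A\<^sub>2"
    using assms(1,2) smooth_manifold_differentiable_atlas by (auto simp: finsler_manifold_def)
  note P = differentiable_product_atlas[OF A]
  obtain p q v where w_eq: "w = ((p, q), v)" by (cases w) auto
  obtain d\<^sub>1 d\<^sub>2 where \<kappa>_eq: "\<kappa> = product_chart d\<^sub>1 d\<^sub>2" and d: "d\<^sub>1 \<in> A\<^sub>1" "p \<in> chart_dom d\<^sub>1" "d\<^sub>2 \<in> A\<^sub>2" "q \<in> chart_dom d\<^sub>2"
    using \<kappa> by (auto simp: w_eq product_atlas_iff)
  let ?x = "(coord d\<^sub>1 p, coord d\<^sub>2 q)"
  have x: "coord \<kappa> (p, q) = ?x" by (simp add: \<kappa>_eq)
  interpret warped_blocks "\<lambda>a. (a, 0)" "\<lambda>b. (0, b)" fst snd "chart_range d\<^sub>1" "chart_range d\<^sub>2"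
    "local_rep A\<^sub>1 F\<^sub>1 d\<^sub>1" "local_rep A\<^sub>2 F\<^sub>2 d\<^sub>2" "local_rep ?P ?F \<kappa>"
    "\<lambda>x. (f\<^sub>1 (inv_coord d\<^sub>1 x))\<^sup>2" "\<lambda>x. (f\<^sub>2 (inv_coord d\<^sub>2 x))\<^sup>2"
    unfolding \<kappa>_eq by (rule warped_blocks_doubly_warped[OF assms(1-6) d(1,3)])
  \<comment> \<open>Once \<open>w\<close> is rebuilt from its components, membership in the doubly
    slit bundle says that both component blocks are nonzero.\<close>
  have "tangent_of ?P \<kappa> ?x (v \<kappa>) = w"
    using tangent_of_components[OF P _ \<kappa>(1), of "(p, q)" v] w \<kappa>
    by (simp add: w_eq x doubly_slit_bundle_def)
  then have v: "fst (v \<kappa>) \<noteq> 0" "snd (v \<kappa>) \<noteq> 0"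
    using w tangent_of_in_doubly_slit_bundle[OF A d, of "fst (v \<kappa>)" "snd (v \<kappa>)"] by (auto simp: \<kappa>_eq)
  have "landsberg (local_rep ?P ?F \<kappa>) I J K ?x (v \<kappa>) = 0"
  proof (rule isotropic_landsberg_zero[OF _ _ v IJK])
    fix z I J K :: "'a \<times> 'b"
    assume z: "fst z \<noteq> 0" "snd z \<noteq> 0" and IJK: "I \<in> Basis" "J \<in> Basis" "K \<in> Basis"
    let ?w = "tangent_of ?P \<kappa> ?x z"
    \<comment> \<open>Isotropy at \<open>w\<close> alone does not suffice. Each coordinate vector
      \<open>z\<close> with nonzero blocks is lifted to a tangent vector over the same point, where
      the scalar is again \<open>c (p, q)\<close>.\<close>
    have "?w \<in> doubly_slit_bundle A\<^sub>1 A\<^sub>2"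
      using tangent_of_in_doubly_slit_bundle[OF A d, of "fst z" "snd z"] z by (simp add: \<kappa>_eq)
    moreover have "fst ?w = (p, q)" "snd ?w \<kappa> = z"
      using tangent_of_eq[OF P \<kappa>(1), of "(p, q)" z] \<kappa> transition_deriv_refl[OF P \<kappa>(1), of "(p, q)" z]
      by (simp_all add: w_eq x)
    ultimately show "landsberg (local_rep ?P ?F \<kappa>) I J K ?x z
        = c (p, q) * local_rep ?P ?F \<kappa> ?x z * cartan (local_rep ?P ?F \<kappa>) I J K ?x z"
      using assms(7) \<kappa> IJK x
      by (auto simp: relatively_isotropic_landsberg_on_def w_eq local_rep_def[of ?P ?F \<kappa> ?x] dest!: bspec[of _ _ ?w])
  qed (use d in \<open>simp_all add: chart_range_def\<close>)
  then show "landsberg (local_rep ?P ?F \<kappa>) I J K (coord \<kappa> (fst w)) (snd w \<kappa>) = 0"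
    by (simp add: w_eq x)
qed

end
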